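(* Let $k\ge 1$. For all $t\in\mathbb{R}$ and $f\in C^\infty(\mathbb{R})$, the map $V_{f,t}:J^k(\mathbb{R})\to\{x=t\}$ is locally $\frac{1}{k+1}$-Hölder (with respect to $d_{cc}$ on both sides).
   Context: Let $k\ge 1$ be an integer. The jet space Carnot group $J^k(\mathbb{R})$ is the set $\mathbb{R}^{k+2}$, with points written $(x,u_k,\ldots,u_0)$, equipped with the group operation $(x,u_k,\ldots,u_0)\odot(y,v_k,\ldots,v_0)=(x+y,w_k,\ldots,w_0)$, where $w_k=u_k+v_k$ and $w_s=u_s+v_s+\sum_{j=s+1}^k u_j\frac{y^{j-s}}{(j-s)!}$ for $s=0,\ldots,k-1$; inverses $p^{-1}$ are with respect to $\odot$. The horizontal bundle is framed by the left-invariant vector fields $X^{(k)}=\frac{\partial}{\partial x}+u_k\frac{\partial}{\partial u_{k-1}}+\cdots+u_1\frac{\partial}{\partial u_0}$ and $\frac{\partial}{\partial u_k}$, declared orthonormal; a horizontal curve is a curve that is absolutely continuous into $\mathbb{R}^{k+2}$ and whose derivative lies a.e. in the horizontal bundle. The Carnot–Carathéodory distance $d_{cc}(p,q)$ is the infimum of lengths of horizontal curves connecting $p$ to $q$. For $f\in C^\infty(\mathbb{R})$ and $x\in\mathbb{R}$, $j^k_x(f):=(x,f^{(k)}(x),f^{(k-1)}(x),\ldots,f(x))\in J^k(\mathbb{R})$. For $t\in\mathbb{R}$, $\{x=t\}:=\{(x,u_k,\ldots,u_0)\in J^k(\mathbb{R}):x=t\}$. For $f\in C^\infty(\mathbb{R})$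 and $t\in\mathbb{R}$, the vertical mapping $V_{f,t}:J^k(\mathbb{R})\to\{x=t\}$ is $V_{f,t}(x,u_k,\ldots,u_0):=(x,u_k,\ldots,u_0)\odot j^k_{x-t}(f)^{-1}$. "Locally $\frac{1}{k+1}$-Hölder" means that for each compact set $K$ there is a constant $C_K$ with $d_{cc}(V_{f,t}(p),V_{f,t}(q))\le C_K\,d_{cc}(p,q)^{1/(k+1)}$ for all $p,q\in K$. *)

theory Defs
  imports "HOL-Analysis.Analysis" "HOL-Algebra.Group"
begin

text \<open>
  A point \<open>(x, u\<^sub>k, \<dots>, u\<^sub>0)\<close> is encoded as the pair of \<open>x\<close> and the function \<open>s \<mapsto> u\<^sub>s\<close>,
  which vanishes above \<open>k\<close>. On \<open>jet_space k\<close> the topology of the type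
  (product topology on \<open>nat \<Rightarrow> real\<close>) induces the Euclidean topology of \<open>\<real>\<^sup>k\<^sup>+\<^sup>2\<close>, so
  \<open>compact\<close> has its usual meaning for subsets of \<open>jet_space k\<close>.
\<close>

type_synonym jet = "real \<times> (nat \<Rightarrow> real)"

definition jet_space :: "nat \<Rightarrow> jet set" where
  "jet_space k = {p. \<forall>s>k. snd p s = 0}"

text \<open>For \<open>s = k\<close> the sum is empty, which gives \<open>w\<^sub>k = u\<^sub>k + v\<^sub>k\<close>.\<close>

definition jet_mult :: "nat \<Rightarrow> jet \<Rightarrow> jet \<Rightarrow> jet" where
  "jet_mult k p q =
     (fst p + fst q,
      \<lambda>s. if s \<le> k
          then snd p s + snd q s + (\<Sum>j=s+1..k. snd p j * (fst q ^ (j - s) / fact (j - s)))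
          else 0)"

definition jet_group :: "nat \<Rightarrow> jet monoid" where
  "jet_group k = \<lparr>carrier = jet_space k, monoid.mult = jet_mult k, one = (0, \<lambda>s. 0)\<rparr>"

subsection \<open>Horizontal bundle\<close>

definition field_X :: "nat \<Rightarrow> jet \<Rightarrow> jet" where
  "field_X k p = (1, \<lambda>s. if s < k then snd p (Suc s) else 0)"

definition field_U :: "nat \<Rightarrow> jet \<Rightarrow> jet" where
  "field_U k p = (0, \<lambda>s. if s = k then 1 else 0)"

definition frame_comb :: "nat \<Rightarrow> jet \<Rightarrow> real \<Rightarrow> real \<Rightarrow> jet" where
  "frame_comb k p a b =
     (a * fst (field_X k p) + b * fst (field_U k p),
      \<lambda>s. a * snd (field_X k p) s + b * snd (field_U k p) s)"

definition horizontal_space :: "nat \<Rightarrow> jet \<Rightarrow> jet set" where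
  "horizontal_space k p = {frame_comb k p a b | a b. True}"

text \<open>The norm on \<open>horizontal_space k p\<close> for which the frame is orthonormal;
  unspecified for other tangent vectors.\<close>

definition horizontal_norm :: "nat \<Rightarrow> jet \<Rightarrow> jet \<Rightarrow> real" where
  "horizontal_norm k p v = (THE r. \<exists>a b. v = frame_comb k p a b \<and> r = sqrt (a\<^sup>2 + b\<^sup>2))"

lemma frame_comb_inject:
  "frame_comb k p a b = frame_comb k p a' b' \<longleftrightarrow> a = a' \<and> b = b'"
proof
  assume eq: "frame_comb k p a b = frame_comb k p a' b'"
  then have "fst (frame_comb k p a b) = fst (frame_comb k p a' b')"
    "snd (frame_comb k p a b) k = snd (frame_comb k p a' b') k" by simp_all
  then show "a = a' \<and> b = b'"
    by (simp add: frame_comb_def field_X_def field_U_def)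
qed simp

lemma horizontal_norm_frame_comb:
  "horizontal_norm k p (frame_comb k p a b) = sqrt (a\<^sup>2 + b\<^sup>2)"
  unfolding horizontal_norm_def frame_comb_inject by (rule the_equality) auto

subsection \<open>Horizontal curves and the Carnot--Caratheodory distance\<close>

definition euclidean_jet_dist :: "nat \<Rightarrow> jet \<Rightarrow> jet \<Rightarrow> real" where
  "euclidean_jet_dist k p q =
     sqrt ((fst p - fst q)\<^sup>2 + (\<Sum>s\<le>k. (snd p s - snd q s)\<^sup>2))"

definition absolutely_continuous_curve ::
    "nat \<Rightarrow> (real \<Rightarrow> jet) \<Rightarrow> real \<Rightarrow> real \<Rightarrow> bool" where
  "absolutely_continuous_curve k \<gamma> a b \<longleftrightarrow>
     (\<forall>\<epsilon>>0. \<exists>\<delta>>0. \<forall>(n::nat) l r.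
        (\<forall>i<n. a \<le> l i \<and> l i \<le> r i \<and> r i \<le> b) \<and>
        disjoint_family_on (\<lambda>i. {l i<..<r i}) {..<n} \<and>
        (\<Sum>i<n. r i - l i) < \<delta>
        \<longrightarrow> (\<Sum>i<n. euclidean_jet_dist k (\<gamma> (l i)) (\<gamma> (r i))) < \<epsilon>)"

definition has_velocity :: "(real \<Rightarrow> jet) \<Rightarrow> jet \<Rightarrow> real \<Rightarrow> bool" where
  "has_velocity \<gamma> v \<tau> \<longleftrightarrow>
     ((\<lambda>\<sigma>. fst (\<gamma> \<sigma>)) has_real_derivative fst v) (at \<tau>) \<and>
     (\<forall>s. ((\<lambda>\<sigma>. snd (\<gamma> \<sigma>) s) has_real_derivative snd v s) (at \<tau>))"

definition velocity :: "(real \<Rightarrow> jet) \<Rightarrow> real \<Rightarrow> jet" where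
  "velocity \<gamma> \<tau> = (deriv (\<lambda>\<sigma>. fst (\<gamma> \<sigma>)) \<tau>, \<lambda>s. deriv (\<lambda>\<sigma>. snd (\<gamma> \<sigma>) s) \<tau>)"

definition horizontal_curve :: "nat \<Rightarrow> (real \<Rightarrow> jet) \<Rightarrow> real \<Rightarrow> real \<Rightarrow> bool" where
  "horizontal_curve k \<gamma> a b \<longleftrightarrow>
     \<gamma> ` {a..b} \<subseteq> jet_space k \<and>
     absolutely_continuous_curve k \<gamma> a b \<and>
     (AE \<tau> in lebesgue. \<tau> \<in> {a<..<b} \<longrightarrow>
        (\<exists>v \<in> horizontal_space k (\<gamma> \<tau>). has_velocity \<gamma> v \<tau>))"

text \<open>The completed measure makes the integrand measurable whatever its values are on the
  null set where the curve is not differentiable. The integral is finite for every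
  horizontal curve, since derivatives of absolutely continuous curves are integrable.\<close>

definition cc_length :: "nat \<Rightarrow> (real \<Rightarrow> jet) \<Rightarrow> real \<Rightarrow> real \<Rightarrow> real" where
  "cc_length k \<gamma> a b = (LINT \<tau>:{a..b}|lebesgue. horizontal_norm k (\<gamma> \<tau>) (velocity \<gamma> \<tau>))"

text \<open>For points of \<open>jet_space k\<close> the set below is nonempty by Chow's theorem, so the
  conditionally complete infimum on the reals is the true infimum.\<close>

definition cc_dist :: "nat \<Rightarrow> jet \<Rightarrow> jet \<Rightarrow> real" where
  "cc_dist k p q =
     Inf {cc_length k \<gamma> a b | \<gamma> a b. a < b \<and> horizontal_curve k \<gamma> a b \<and> \<gamma> a = p \<and> \<gamma> b = q}"

subsection \<open>Jets of smooth functions and vertical mappings\<close>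

definition smooth :: "(real \<Rightarrow> real) \<Rightarrow> bool" where
  "smooth f \<longleftrightarrow> (\<forall>n x. (deriv ^^ n) f field_differentiable at x)"

definition jet_of :: "nat \<Rightarrow> (real \<Rightarrow> real) \<Rightarrow> real \<Rightarrow> jet" where
  "jet_of k f x = (x, \<lambda>s. if s \<le> k then (deriv ^^ s) f x else 0)"

definition jet_hyperplane :: "nat \<Rightarrow> real \<Rightarrow> jet set" where
  "jet_hyperplane k t = {p \<in> jet_space k. fst p = t}"

definition vertical_map :: "nat \<Rightarrow> (real \<Rightarrow> real) \<Rightarrow> real \<Rightarrow> jet \<Rightarrow> jet" where
  "vertical_map k f t p =
     p \<otimes>\<^bsub>jet_group k\<^esub> (inv\<^bsub>jet_group k\<^esub> (jet_of k f (fst p - t)))"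

definition locally_hoelder_on ::
    "real \<Rightarrow> 'a::topological_space set \<Rightarrow> ('a \<Rightarrow> 'a \<Rightarrow> real) \<Rightarrow> ('b \<Rightarrow> 'b \<Rightarrow> real) \<Rightarrow> ('a \<Rightarrow> 'b) \<Rightarrow> bool" where
  "locally_hoelder_on \<alpha> S d d' F \<longleftrightarrow>
     (\<forall>K. compact K \<and> K \<subseteq> S \<longrightarrow>
        (\<exists>C. \<forall>p\<in>K. \<forall>q\<in>K. d' (F p) (F q) \<le> C * d p q powr \<alpha>))"

end

theory Submission
  imports Defs
begin

text \<open>
  Put \<open>N\<close> for the nilpotent operator \<open>(N u)\<^sub>s = u\<^sub>s\<^sub>+\<^sub>1\<close> on the \<open>u\<close>-coordinates. The group law is
  \<open>(x, u) \<odot> (y, v) = (x + y, exp (y N) u + v)\<close>, so the vertical map is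
  \<open>(x, u) \<mapsto> (t, exp ((t - x) N) (u - v))\<close> with \<open>v\<^sub>s = f\<^sup>(\<^sup>s\<^sup>) (x - t)\<close>
  (\<open>vertical_map_eq\<close>). In coordinates this is a smooth map. The theorem follows by comparing
  \<open>d\<^sub>c\<^sub>c\<close> with coordinate differences in both directions; the exponent \<open>1 / (k + 1)\<close> comes from the
  second comparison.

  Source side: on a bounded set every coordinate is Lipschitz for \<open>d\<^sub>c\<^sub>c\<close>
  (\<open>coordinate_le_cc_dist\<close>). Along a horizontal curve with speed \<open>n\<close> one has \<open>|x'| \<le> n\<close>,
  \<open>|u\<^sub>k'| \<le> n\<close> and \<open>|u\<^sub>s'| \<le> n |u\<^sub>s\<^sub>+\<^sub>1|\<close>; descending from \<open>s = k\<close>, a curve of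
  length at most 1 keeps every \<open>u\<^sub>s\<close> bounded, and integration bounds its increment by a multiple
  of the length. The curves are merely absolutely continuous, so this rests on the
  fundamental theorem of calculus for such functions and on the integrability of their derivatives
  (\<open>absolutely_continuous_fun_has_integral\<close>, \<open>absolutely_continuous_fun_absolutely_integrable\<close>).

  Target side: two points of the same hyperplane \<open>{x = t}\<close> whose \<open>u\<close>-coordinates differ by \<open>\<rho>\<close>
  in total satisfy \<open>d\<^sub>c\<^sub>c \<le> C \<rho>\<^sup>1\<^sup>/\<^sup>(\<^sup>k\<^sup>+\<^sup>1\<^sup>)\<close> as long as
  \<open>\<rho>\<close> stays bounded (\<open>cc_dist_vertical_le\<close>). Walk from \<open>x = t\<close> to \<open>x = t + h\<close> along the jets of the Taylor polynomial \<open>g\<close> of the first point, and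
  return along the jets of \<open>g + D\<close>, where the polynomial \<open>D\<close> has vanishing jet at \<open>t + h\<close> and at \<open>t\<close>
  the difference of the two jets. Scaling a fixed interpolation basis gives
  \<open>|D\<^sup>(\<^sup>k\<^sup>+\<^sup>1\<^sup>)| \<le> M \<Sum>\<^sub>s |r\<^sub>s| h\<^sup>s\<^sup>-\<^sup>k\<^sup>-\<^sup>1\<close> for coordinate differences \<open>r\<^sub>s\<close>, so the length
  is at most \<open>2 h (1 + M \<Sum>\<^sub>s |r\<^sub>s| h\<^sup>s\<^sup>-\<^sup>k\<^sup>-\<^sup>1)\<close>, which is of order \<open>h\<close> for the choice
  \<open>h = \<rho>\<^sup>1\<^sup>/\<^sup>(\<^sup>k\<^sup>+\<^sup>1\<^sup>)\<close>.
\<close>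

section \<open>Absolutely continuous functions of a real variable\<close>

text \<open>
  The families of intervals are those used for curves of jets, so the coordinates of an absolutely
  continuous curve inherit the property by comparing sums term by term.
\<close>

definition absolutely_continuous_fun :: "(real \<Rightarrow> real) \<Rightarrow> real \<Rightarrow> real \<Rightarrow> bool" where
  "absolutely_continuous_fun \<phi> a b \<longleftrightarrow>
     (\<forall>\<epsilon>>0. \<exists>\<delta>>0. \<forall>(n::nat) l r.
        (\<forall>i<n. a \<le> l i \<and> l i \<le> r i \<and> r i \<le> b) \<and>
        disjoint_family_on (\<lambda>i. {l i<..<r i}) {..<n} \<and>
        (\<Sum>i<n. r i - l i) < \<delta>
        \<longrightarrow> (\<Sum>i<n. \<bar>\<phi> (r i) - \<phi> (l i)\<bar>) < \<epsilon>)"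

text \<open>
  The tagged divisions of gauge integration are indexed by arbitrary finite sets rather than by
  initial segments of the naturals; an enumeration of the index set makes up the difference.
\<close>

lemma absolutely_continuous_fun_finite_sum:
  fixes l r :: "'i \<Rightarrow> real"
  assumes ac: "\<And>(n::nat) l r. (\<forall>i<n. a \<le> l i \<and> l i \<le> r i \<and> r i \<le> b) \<Longrightarrow>
        disjoint_family_on (\<lambda>i. {l i<..<r i}) {..<n} \<Longrightarrow> (\<Sum>i<n. r i - l i) < \<delta>
        \<Longrightarrow> (\<Sum>i<n. \<bar>\<phi> (r i) - \<phi> (l i)\<bar>) < \<epsilon>"
    and fin: "finite I"
    and sub: "\<And>i. i \<in> I \<Longrightarrow> a \<le> l i \<and> l i \<le> r i \<and> r i \<le> b"
    and disj: "disjoint_family_on (\<lambda>i. {l i<..<r i}) I"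
    and small: "(\<Sum>i\<in>I. r i - l i) < \<delta>"
  shows "(\<Sum>i\<in>I. \<bar>\<phi> (r i) - \<phi> (l i)\<bar>) < \<epsilon>"
proof -
  obtain h where h: "bij_betw h {..<card I} I"
    using ex_bij_betw_nat_finite[OF fin] by (auto simp: atLeast0LessThan)
  have hI: "h i \<in> I" if "i < card I" for i
    using h that by (auto simp: bij_betw_def)
  have "(\<Sum>i<card I. \<bar>\<phi> (r (h i)) - \<phi> (l (h i))\<bar>) < \<epsilon>"
  proof (rule ac)
    show "\<forall>i<card I. a \<le> l (h i) \<and> l (h i) \<le> r (h i) \<and> r (h i) \<le> b"
      using sub hI by blast
    show "disjoint_family_on (\<lambda>i. {l (h i)<..<r (h i)}) {..<card I}"
      unfolding disjoint_family_on_def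
    proof (intro ballI impI)
      fix m n assume mn: "m \<in> {..<card I}" "n \<in> {..<card I}" "m \<noteq> n"
      then have "h m \<noteq> h n"
        using h by (auto simp: bij_betw_def inj_on_def)
      then show "{l (h m)<..<r (h m)} \<inter> {l (h n)<..<r (h n)} = {}"
        using disj hI mn unfolding disjoint_family_on_def by blast
    qed
    show "(\<Sum>i<card I. r (h i) - l (h i)) < \<delta>"
      using small sum.reindex_bij_betw[OF h, of "\<lambda>i. r i - l i"] by simp
  qed
  then show ?thesis
    using sum.reindex_bij_betw[OF h, of "\<lambda>i. \<bar>\<phi> (r i) - \<phi> (l i)\<bar>"] by simp
qed

lemma absolutely_continuous_fun_subinterval:
  assumes "absolutely_continuous_fun \<phi> a b" "a \<le> c" "d \<le> b"
  shows "absolutely_continuous_fun \<phi> c d"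
  unfolding absolutely_continuous_fun_def
proof (intro allI impI)
  fix \<epsilon> :: real assume "\<epsilon> > 0"
  then obtain \<delta> where "\<delta> > 0" and \<delta>: "\<forall>(n::nat) l r.
        (\<forall>i<n. a \<le> l i \<and> l i \<le> r i \<and> r i \<le> b) \<and>
        disjoint_family_on (\<lambda>i. {l i<..<r i}) {..<n} \<and>
        (\<Sum>i<n. r i - l i) < \<delta>
        \<longrightarrow> (\<Sum>i<n. \<bar>\<phi> (r i) - \<phi> (l i)\<bar>) < \<epsilon>"
    using assms(1) unfolding absolutely_continuous_fun_def by meson
  show "\<exists>\<delta>>0. \<forall>(n::nat) l r.
        (\<forall>i<n. c \<le> l i \<and> l i \<le> r i \<and> r i \<le> d) \<and>
        disjoint_family_on (\<lambda>i. {l i<..<r i}) {..<n} \<and>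
        (\<Sum>i<n. r i - l i) < \<delta>
        \<longrightarrow> (\<Sum>i<n. \<bar>\<phi> (r i) - \<phi> (l i)\<bar>) < \<epsilon>"
  proof (intro exI[of _ \<delta>] conjI allI impI \<open>\<delta> > 0\<close>)
    fix n :: nat and l r
    assume *: "(\<forall>i<n. c \<le> l i \<and> l i \<le> r i \<and> r i \<le> d) \<and>
        disjoint_family_on (\<lambda>i. {l i<..<r i}) {..<n} \<and> (\<Sum>i<n. r i - l i) < \<delta>"
    then have "\<forall>i<n. a \<le> l i \<and> l i \<le> r i \<and> r i \<le> b"
      using assms(2,3) by force
    with * \<delta> show "(\<Sum>i<n. \<bar>\<phi> (r i) - \<phi> (l i)\<bar>) < \<epsilon>" by blast
  qed
qed

text \<open>
  The gauge treats the two kinds of tags separately. At a tag outside \<open>N\<close> the derivative makes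
  \<open>f x\<close> times the length of the interval a good approximation of the increment of \<open>\<phi>\<close>. Intervals
  with a tag in \<open>N\<close> are forced into an open set \<open>G\<close> of measure below \<open>\<delta>\<close>, so their total length is
  below \<open>\<delta>\<close> and absolute continuity makes the sum of their increments small.
\<close>

lemma absolutely_continuous_fun_has_integral:
  fixes \<phi> f :: "real \<Rightarrow> real"
  assumes "a \<le> b" and ac: "absolutely_continuous_fun \<phi> a b" and N: "negligible N"
    and der: "\<And>x. x \<in> {a..b} - N \<Longrightarrow> (\<phi> has_real_derivative f x) (at x)"
  shows "(f has_integral (\<phi> b - \<phi> a)) {a..b}"
proof -
  define g where "g x = (if x \<in> N then 0 else f x)" for x
  have "(g has_integral (\<phi> b - \<phi> a)) {a..b}"
    unfolding has_integral_real
  proof (intro allI impI)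
    fix e :: real assume "e > 0"
    \<comment> \<open>The good tags contribute at most \<open>e' (b - a)\<close>; adding 1 covers the case \<open>a = b\<close>.\<close>
    define e' where "e' = e / (2 * (b - a + 1))"
    have e': "e' > 0" "e' * (b - a) < e / 2"
      using \<open>e > 0\<close> \<open>a \<le> b\<close> by (auto simp: e'_def field_simps add_pos_nonneg)
    obtain \<delta> where "\<delta> > 0" and \<delta>: "\<And>(n::nat) l r.
        (\<forall>i<n. a \<le> l i \<and> l i \<le> r i \<and> r i \<le> b) \<Longrightarrow>
        disjoint_family_on (\<lambda>i. {l i<..<r i}) {..<n} \<Longrightarrow> (\<Sum>i<n. r i - l i) < \<delta>
        \<Longrightarrow> (\<Sum>i<n. \<bar>\<phi> (r i) - \<phi> (l i)\<bar>) < e / 2"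
      using ac[unfolded absolutely_continuous_fun_def, rule_format, of "e / 2"] \<open>e > 0\<close> by auto
    obtain G where G: "open G" "N \<subseteq> G" "(G - N) \<in> lmeasurable" "emeasure lebesgue (G - N) < ennreal \<delta>"
      using sets_lebesgue_outer_open[OF negligible_imp_sets[OF N] \<open>\<delta> > 0\<close>] by blast
    have Gm: "G \<in> lmeasurable" "measure lebesgue G < \<delta>"
    proof -
      have eq: "G = (G - N) \<union> N" using G by blast
      have Nm: "N \<in> lmeasurable" using N negligible_imp_measurable by blast
      show "G \<in> lmeasurable" by (subst eq) (intro fmeasurable.Un G Nm)
      have "measure lebesgue G \<le> measure lebesgue (G - N) + measure lebesgue N"
        by (subst eq) (intro measure_Un_le fmeasurableD G Nm)
      also have "\<dots> = measure lebesgue (G - N)"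
        using N by (simp add: negligible_imp_measure0)
      also have "\<dots> < \<delta>"
        using G(3,4) \<open>\<delta> > 0\<close> by (simp add: emeasure_eq_measure2 ennreal_less_iff)
      finally show "measure lebesgue G < \<delta>" .
    qed
    have "\<exists>d>0. x \<in> {a..b} - N \<longrightarrow>
       (\<forall>y. \<bar>y - x\<bar> < d \<longrightarrow> \<bar>\<phi> y - \<phi> x - (y - x) * f x\<bar> \<le> e' * \<bar>y - x\<bar>)" for x
    proof (cases "x \<in> {a..b} - N")
      case True
      from der[OF True] e'(1) show ?thesis
        unfolding has_field_derivative_def has_derivative_at_alt
        by (auto simp: mult.commute)
    qed (auto intro: exI[of _ 1])
    then obtain d where d: "\<And>x. d x > 0" "\<And>x y. x \<in> {a..b} - N \<Longrightarrow> \<bar>y - x\<bar> < d x \<Longrightarrow>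
         \<bar>\<phi> y - \<phi> x - (y - x) * f x\<bar> \<le> e' * \<bar>y - x\<bar>"
      by metis
    \<comment> \<open>On \<open>N\<close>, fineness forces the interval into \<open>G\<close>; elsewhere it enforces the derivative estimate.\<close>
    define \<gamma> where "\<gamma> x = (if x \<in> N then G else ball x (d x))" for x
    have "gauge \<gamma>"
      using G(1,2) d(1) by (auto simp: gauge_def \<gamma>_def)
    moreover have "norm ((\<Sum>(x, K)\<in>D. measure lborel K *\<^sub>R g x) - (\<phi> b - \<phi> a)) < e"
      if D: "D tagged_division_of {a..b}" "\<gamma> fine D" for D
    proof -
      note Dp = tagged_division_ofD[OF D(1)]
      have K: "\<exists>u v. K = {u..v} \<and> u \<le> v \<and> a \<le> u \<and> v \<le> b \<and> u \<le> x \<and> x \<le> v" if "(x, K) \<in> D" for x K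
      proof -
        from Dp(4)[OF that] obtain u v where "K = cbox u v" by blast
        with Dp(2)[OF that] Dp(3)[OF that] show ?thesis
          by (intro exI[of _ u] exI[of _ v]) auto
      qed
      have KD: "K = {Inf K..Sup K}" "Inf K \<le> Sup K" "a \<le> Inf K" "Sup K \<le> b" "Inf K \<le> x" "x \<le> Sup K"
        "measure lborel K = Sup K - Inf K" if "(x, K) \<in> D" for x K
        using K[OF that] by auto
      define DN where "DN = {z \<in> D. fst z \<in> N}"
      define DG where "DG = {z \<in> D. fst z \<notin> N}"
      have fin: "finite D" "finite DN" "finite DG" using Dp(1) by (auto simp: DN_def DG_def)
      have Dsplit: "D = DN \<union> DG" "DN \<inter> DG = {}" by (auto simp: DN_def DG_def)
      have tele: "b - a = (\<Sum>(x,K)\<in>D. Sup K - Inf K)" "\<phi> b - \<phi> a = (\<Sum>(x,K)\<in>D. \<phi> (Sup K) - \<phi> (Inf K))"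
        using additive_tagged_division_1[OF \<open>a \<le> b\<close> D(1), of "\<lambda>x. x"]
          additive_tagged_division_1[OF \<open>a \<le> b\<close> D(1), of \<phi>] by auto
      have good: "\<bar>measure lborel K *\<^sub>R g x - (\<phi> (Sup K) - \<phi> (Inf K))\<bar> \<le> e' * (Sup K - Inf K)" if "(x, K) \<in> DG" for x K
      proof -
        have xK: "(x, K) \<in> D" "x \<notin> N" using that by (auto simp: DG_def)
        note k = KD[OF xK(1)]
        have x: "x \<in> {a..b} - N" using k xK by auto
        have "K \<subseteq> ball x (d x)"
          using bspec[OF D(2)[unfolded fine_def] xK(1)] xK(2) by (simp add: \<gamma>_def)
        moreover have "Inf K \<in> K" "Sup K \<in> K" using k by (metis atLeastAtMost_iff order_refl)+
        ultimately have bd: "\<bar>Inf K - x\<bar> < d x" "\<bar>Sup K - x\<bar> < d x"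
          by (auto simp: dist_real_def abs_minus_commute subset_iff)
        have "measure lborel K *\<^sub>R g x - (\<phi> (Sup K) - \<phi> (Inf K)) =
           (\<phi> (Inf K) - \<phi> x - (Inf K - x) * f x) - (\<phi> (Sup K) - \<phi> x - (Sup K - x) * f x)"
          unfolding k(7) using xK(2) by (simp add: g_def algebra_simps)
        also have "\<bar>\<dots>\<bar> \<le> e' * \<bar>Inf K - x\<bar> + e' * \<bar>Sup K - x\<bar>"
          using d(2)[OF x bd(1)] d(2)[OF x bd(2)] by linarith
        also have "\<dots> = e' * (Sup K - Inf K)"
          using k(5,6) by (simp add: algebra_simps)
        finally show ?thesis .
      qed
      \<comment> \<open>The errors at good tags are small by differentiability.\<close>
      have 1: "(\<Sum>(x,K)\<in>DG. \<bar>measure lborel K *\<^sub>R g x - (\<phi> (Sup K) - \<phi> (Inf K))\<bar>) \<le> e' * (b - a)"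
      proof -
        have "(\<Sum>(x,K)\<in>DG. \<bar>measure lborel K *\<^sub>R g x - (\<phi> (Sup K) - \<phi> (Inf K))\<bar>) \<le> (\<Sum>(x,K)\<in>DG. e' * (Sup K - Inf K))"
          using good by (intro sum_mono) auto
        also have "\<dots> \<le> (\<Sum>(x,K)\<in>D. e' * (Sup K - Inf K))"
        proof (rule sum_mono2)
          fix z assume "z \<in> D - DG"
          then have "Inf (snd z) \<le> Sup (snd z)" using KD(2)[of "fst z" "snd z"] by simp
          then show "0 \<le> (case z of (x, K) \<Rightarrow> e' * (Sup K - Inf K))"
            using e'(1) by (simp add: case_prod_unfold)
        qed (use fin Dsplit in auto)
        also have "\<dots> = e' * (b - a)"
          by (simp add: tele sum_distrib_left case_prod_unfold)
        finally show ?thesis .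
      qed
      \<comment> \<open>The increments at bad tags are small by absolute continuity, as the intervals lie in \<open>G\<close>.\<close>
      have "(\<Sum>z\<in>DN. \<bar>\<phi> (Sup (snd z)) - \<phi> (Inf (snd z))\<bar>) < e / 2"
      proof (rule absolutely_continuous_fun_finite_sum[OF \<delta> fin(2)])
        show "a \<le> Inf (snd z) \<and> Inf (snd z) \<le> Sup (snd z) \<and> Sup (snd z) \<le> b" if "z \<in> DN" for z
          using KD[of "fst z" "snd z"] that by (auto simp: DN_def)
        have intr: "interior (snd z) = {Inf (snd z)<..<Sup (snd z)}" if "z \<in> D" for z
          using KD(1)[of "fst z" "snd z"] that
          by (metis interior_atLeastAtMost_real prod.collapse)
        show disj: "disjoint_family_on (\<lambda>z. {Inf (snd z)<..<Sup (snd z)}) DN"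
          unfolding disjoint_family_on_def
        proof (intro ballI impI)
          fix z w assume zw: "z \<in> DN" "w \<in> DN" "z \<noteq> w"
          then have "interior (snd z) \<inter> interior (snd w) = {}"
            using Dp(5)[of "fst z" "snd z" "fst w" "snd w"] by (auto simp: DN_def)
          then show "{Inf (snd z)<..<Sup (snd z)} \<inter> {Inf (snd w)<..<Sup (snd w)} = {}"
            using intr zw by (auto simp: DN_def)
        qed
        have "(\<Sum>z\<in>DN. Sup (snd z) - Inf (snd z)) = (\<Sum>z\<in>DN. measure lebesgue {Inf (snd z)<..<Sup (snd z)})"
          using KD(2) by (intro sum.cong) (auto simp: DN_def)
        also have "\<dots> = measure lebesgue (\<Union>z\<in>DN. {Inf (snd z)<..<Sup (snd z)})"
          proof (rule measure_finite_Union[symmetric])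
          show "emeasure lebesgue {Inf (snd z)<..<Sup (snd z)} \<noteq> \<infinity>" if "z \<in> DN" for z
            using KD(2)[of "fst z" "snd z"] that by (simp add: DN_def)
        qed (use fin(2) disj in auto)
        also have "\<dots> \<le> measure lebesgue G"
        proof (rule measure_mono_fmeasurable)
          show "(\<Union>z\<in>DN. {Inf (snd z)<..<Sup (snd z)}) \<subseteq> G"
          proof
            fix y assume "y \<in> (\<Union>z\<in>DN. {Inf (snd z)<..<Sup (snd z)})"
            then obtain x K where xK: "(x, K) \<in> D" "x \<in> N" "y \<in> {Inf K<..<Sup K}"
              by (auto simp: DN_def)
            then have "y \<in> K" using KD(1)[OF xK(1)] 
              by (metis atLeastAtMost_iff greaterThanLessThan_iff less_imp_le)
            moreover have "K \<subseteq> G"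
              using bspec[OF D(2)[unfolded fine_def] xK(1)] xK(2) by (simp add: \<gamma>_def)
            ultimately show "y \<in> G" by blast
          qed
          show "(\<Union>z\<in>DN. {Inf (snd z)<..<Sup (snd z)}) \<in> sets lebesgue"
            using fin(2) by (intro sets.finite_UN) auto
        qed (rule Gm)
        finally show "(\<Sum>z\<in>DN. Sup (snd z) - Inf (snd z)) < \<delta>" using Gm(2) by simp
      qed
      then have 2: "(\<Sum>(x,K)\<in>DN. \<bar>measure lborel K *\<^sub>R g x - (\<phi> (Sup K) - \<phi> (Inf K))\<bar>) < e / 2"
        by (simp add: case_prod_unfold g_def DN_def abs_minus_commute)
      have "(\<Sum>(x, K)\<in>D. measure lborel K *\<^sub>R g x) - (\<phi> b - \<phi> a)
          = (\<Sum>(x,K)\<in>D. measure lborel K *\<^sub>R g x - (\<phi> (Sup K) - \<phi> (Inf K)))"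
        by (simp add: tele case_prod_unfold sum_subtractf)
      also have "norm \<dots> \<le> (\<Sum>(x,K)\<in>D. \<bar>measure lborel K *\<^sub>R g x - (\<phi> (Sup K) - \<phi> (Inf K))\<bar>)"
        unfolding real_norm_def by (simp add: case_prod_unfold sum_abs)
      also have "\<dots> = (\<Sum>(x,K)\<in>DN. \<bar>measure lborel K *\<^sub>R g x - (\<phi> (Sup K) - \<phi> (Inf K))\<bar>)
            + (\<Sum>(x,K)\<in>DG. \<bar>measure lborel K *\<^sub>R g x - (\<phi> (Sup K) - \<phi> (Inf K))\<bar>)"
        unfolding Dsplit(1) using fin(2,3) Dsplit(2) by (rule sum.union_disjoint)
      also have "\<dots> < e" using 1 2 e'(2) by linarith
      finally show ?thesis .
    qed
    ultimately show "\<exists>\<gamma>. gauge \<gamma> \<and> (\<forall>D. D tagged_division_of {a..b} \<and> \<gamma> fine D \<longrightarrow>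
        norm ((\<Sum>(x, K)\<in>D. measure lborel K *\<^sub>R g x) - (\<phi> b - \<phi> a)) < e)"
      by (intro exI[of _ \<gamma>]) simp
  qed
  then show ?thesis
    by (rule has_integral_spike[OF N, rotated]) (auto simp: g_def)
qed

text \<open>
  On an interval shorter than the \<open>\<delta>\<close> that belongs to \<open>\<epsilon> = 1\<close>, the increments of \<open>\<phi>\<close> over any
  division sum to less than 1. By the preceding theorem these increments are the integrals of \<open>f\<close>,
  so \<open>f\<close> has indefinite integral of bounded variation there and is absolutely integrable. Finitely
  many such intervals cover \<open>{a..b}\<close>.
\<close>

lemma absolutely_continuous_fun_absolutely_integrable:
  fixes \<phi> f :: "real \<Rightarrow> real"
  assumes "a \<le> b" and ac: "absolutely_continuous_fun \<phi> a b" and N: "negligible N"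
    and der: "\<And>x. x \<in> {a..b} - N \<Longrightarrow> (\<phi> has_real_derivative f x) (at x)"
  shows "f absolutely_integrable_on {a..b}"
proof -
  obtain \<delta> where "\<delta> > 0" and \<delta>: "\<And>(n::nat) l r.
      (\<forall>i<n. a \<le> l i \<and> l i \<le> r i \<and> r i \<le> b) \<Longrightarrow>
      disjoint_family_on (\<lambda>i. {l i<..<r i}) {..<n} \<Longrightarrow> (\<Sum>i<n. r i - l i) < \<delta>
      \<Longrightarrow> (\<Sum>i<n. \<bar>\<phi> (r i) - \<phi> (l i)\<bar>) < 1"
    using ac[unfolded absolutely_continuous_fun_def, rule_format, of 1] by auto
  have hi: "(f has_integral (\<phi> d - \<phi> c)) {c..d}" if "a \<le> c" "c \<le> d" "d \<le> b" for c d
    using that der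
    by (intro absolutely_continuous_fun_has_integral[OF _ absolutely_continuous_fun_subinterval[OF ac] N]) auto
  have short: "f absolutely_integrable_on {c..d}" if cd: "a \<le> c" "c \<le> d" "d \<le> b" "d - c < \<delta>" for c d
  proof -
    have "f absolutely_integrable_on cbox c d"
    proof (rule bounded_variation_absolutely_integrable_interval)
      show "f integrable_on cbox c d" using hi[OF cd(1-3)] by auto
      fix D assume D: "D division_of cbox c d"
      note Dp = division_ofD[OF D]
      have KD: "K = {Inf K..Sup K}" "Inf K \<le> Sup K" "c \<le> Inf K" "Sup K \<le> d" if K: "K \<in> D" for K
      proof -
        from Dp(4)[OF K] obtain u v where "K = cbox u v" by blast
        with Dp(2,3)[OF K] show "K = {Inf K..Sup K}" "Inf K \<le> Sup K" "c \<le> Inf K" "Sup K \<le> d" by auto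
      qed
      have "(\<Sum>K\<in>D. \<bar>\<phi> (Sup K) - \<phi> (Inf K)\<bar>) < 1"
      proof (rule absolutely_continuous_fun_finite_sum[OF \<delta> Dp(1)])
        show "a \<le> Inf K \<and> Inf K \<le> Sup K \<and> Sup K \<le> b" if "K \<in> D" for K
          using KD[OF that] cd by auto
        show "disjoint_family_on (\<lambda>K. {Inf K<..<Sup K}) D"
          unfolding disjoint_family_on_def
          using Dp(5) KD(1) by (metis interior_atLeastAtMost_real)
        have "(\<Sum>K\<in>D. Sup K - Inf K) = (\<Sum>K\<in>D. measure lborel K)"
          using KD(1,2) by (intro sum.cong refl) (metis measure_lborel_Icc)
        also have "\<dots> = d - c"
          using additive_content_division[OF D] cd by simp
        finally show "(\<Sum>K\<in>D. Sup K - Inf K) < \<delta>" using cd by simp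
      qed
      moreover have "norm (integral K f) = \<bar>\<phi> (Sup K) - \<phi> (Inf K)\<bar>" if "K \<in> D" for K
      proof -
        have "(f has_integral (\<phi> (Sup K) - \<phi> (Inf K))) {Inf K..Sup K}"
          using KD[OF that] cd by (intro hi) auto
        then show ?thesis
          using KD(1)[OF that] by (metis integral_unique real_norm_def)
      qed
      ultimately show "(\<Sum>K\<in>D. norm (integral K f)) \<le> 1" by simp
    qed
    then show ?thesis by simp
  qed
  define \<eta> where "\<eta> = \<delta> / 2"
  have \<eta>: "\<eta> > 0" "\<eta> < \<delta>" using \<open>\<delta> > 0\<close> by (auto simp: \<eta>_def)
  have "f absolutely_integrable_on {a..min b (a + real m * \<eta>)}" for m
  proof (induction m)
    case 0
    show ?case using \<open>a \<le> b\<close> short[of a a] \<open>\<delta> > 0\<close> by (simp add: min_absorb2)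
  next
    case (Suc m)
    show ?case
    proof (cases "a + real m * \<eta> \<ge> b")
      case True
      moreover have "a + real (Suc m) * \<eta> \<ge> a + real m * \<eta>" using \<eta> by (simp add: algebra_simps)
      ultimately show ?thesis using Suc by (simp add: min_absorb1)
    next
      case False
      let ?c = "a + real m * \<eta>" and ?d = "min b (a + real (Suc m) * \<eta>)"
      have cd: "a \<le> ?c" "?c \<le> ?d" "?d \<le> b" "?d - ?c < \<delta>"
        using False \<eta> by (auto simp: algebra_simps min_def)
      have "f absolutely_integrable_on ({a..?c} \<union> {?c..?d})"
        using Suc False short[OF cd] by (intro absolutely_integrable_Un) (auto simp: min_absorb2)
      moreover have "{a..?c} \<union> {?c..?d} = {a..?d}" using cd by (simp only: ivl_disj_un_two_touch)
      ultimately show ?thesis by simp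
    qed
  qed
  moreover obtain m where "b - a < real m * \<eta>"
    using reals_Archimedean3[OF \<eta>(1)] by blast
  ultimately show ?thesis
    by (metis add.commute diff_less_eq less_imp_le min_absorb1)
qed

lemma absolutely_continuous_fun_increment_le:
  fixes \<phi> f n :: "real \<Rightarrow> real"
  assumes "a \<le> b" and ac: "absolutely_continuous_fun \<phi> a b" and N: "negligible N"
    and der: "\<And>x. x \<in> {a..b} - N \<Longrightarrow> (\<phi> has_real_derivative f x) (at x)"
    and bound: "\<And>x. x \<in> {a..b} - N \<Longrightarrow> \<bar>f x\<bar> \<le> M * n x"
    and int: "n integrable_on {a..b}"
  shows "\<bar>\<phi> b - \<phi> a\<bar> \<le> M * integral {a..b} n"
proof -
  have hi: "(f has_integral (\<phi> b - \<phi> a)) {a..b}"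
    by (rule absolutely_continuous_fun_has_integral[OF assms(1-4)])
  define g where "g x = (if x \<in> N then 0 else f x)" for x
  define m where "m x = (if x \<in> N then 0 else M * n x)" for x
  have g: "(g has_integral (\<phi> b - \<phi> a)) {a..b}"
    by (rule has_integral_spike[OF N _ hi]) (auto simp: g_def)
  have "((\<lambda>x. M * n x) has_integral M * integral {a..b} n) {a..b}"
    using int by (intro has_integral_mult_right integrable_integral)
  then have m: "(m has_integral M * integral {a..b} n) {a..b}"
    by (rule has_integral_spike[OF N, rotated]) (auto simp: m_def)
  have "norm (integral {a..b} g) \<le> integral {a..b} m"
    using g m bound by (intro integral_norm_bound_integral) (auto simp: g_def m_def)
  then show ?thesis using g m by (simp add: integral_unique)
qed

section \<open>Polynomials with prescribed jets\<close>

lemma higher_pderiv_multiple_root: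
  fixes p :: "real poly"
  assumes "[:- a, 1:] ^ n dvd p" "j < n"
  shows "poly ((pderiv ^^ j) p) a = 0"
  using assms
proof (induction j arbitrary: n p)
  case 0
  then have "[:- a, 1:] dvd p"
    by (metis dvd_trans dvd_power gr0_conv_Suc less_imp_neq zero_less_iff_neq_zero)
  then show ?case by (simp add: poly_eq_0_iff_dvd)
next
  case (Suc j)
  then obtain m q where n: "n = Suc m" and q: "p = [:- a, 1:] ^ Suc m * q"
    by (metis Suc_lessE dvdE)
  have "pderiv p = [:- a, 1:] ^ m * (smult (of_nat (Suc m)) q + [:- a, 1:] * pderiv q)"
    unfolding q pderiv_mult pderiv_power_Suc by (simp add: algebra_simps pderiv_pCons)
  then have "[:- a, 1:] ^ m dvd pderiv p" by simp
  then have "poly ((pderiv ^^ j) (pderiv p)) a = 0"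
    using Suc n by auto
  then show ?case by (simp add: funpow_swap1)
qed

lemma poly_higher_pderiv_0:
  fixes p :: "real poly"
  shows "poly ((pderiv ^^ j) p) 0 = fact j * coeff p j"
  by (simp add: poly_0_coeff_0 coeff_higher_pderiv pochhammer_fact)

lemma higher_pderiv_pcompose_linear:
  fixes p :: "real poly"
  shows "(pderiv ^^ n) (pcompose p [:c, d:]) = smult (d ^ n) (pcompose ((pderiv ^^ n) p) [:c, d:])"
  by (induction n) (simp_all add: pderiv_smult pderiv_pcompose pderiv_pCons mult.commute)

lemma taylor_polynomial:
  fixes u :: "nat \<Rightarrow> real"
  obtains g where "\<And>j. j \<le> k \<Longrightarrow> poly ((pderiv ^^ j) g) x = u j" "(pderiv ^^ Suc k) g = 0"
proof
  define P where "P = (\<Sum>s\<le>k. monom (u s / fact s) s)"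
  have cP: "coeff P j = (if j \<le> k then u j / fact j else 0)" for j
    by (simp add: P_def coeff_sum if_distrib cong: if_cong)
  define g where "g = pcompose P [:- x, 1:]"
  show "poly ((pderiv ^^ j) g) x = u j" if "j \<le> k" for j
    using that by (simp add: g_def higher_pderiv_pcompose_linear poly_pcompose poly_higher_pderiv_0 cP)
  have "(pderiv ^^ Suc k) P = 0"
    by (rule poly_eqI) (simp only: coeff_higher_pderiv cP, simp)
  then show "(pderiv ^^ Suc k) g = 0"
    unfolding g_def higher_pderiv_pcompose_linear by simp
qed

text \<open>
  The factor \<open>(1 - z\<^sup>k\<^sup>+\<^sup>1)\<^sup>k\<^sup>+\<^sup>1\<close> agrees with 1 to order \<open>k\<close> at \<open>z = 0\<close> and vanishes to order
  \<open>k\<close> at \<open>z = 1\<close>: a polynomial cutoff that leaves the jet of \<open>z\<^sup>s / s!\<close> at 0 untouched and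
  kills it at 1.
\<close>

definition hermite_basis :: "nat \<Rightarrow> nat \<Rightarrow> real poly" where
  "hermite_basis k s = monom (1 / fact s) s * (1 - monom 1 (Suc k)) ^ Suc k"

lemma hermite_basis_at_1:
  assumes "j \<le> k"
  shows "poly ((pderiv ^^ j) (hermite_basis k s)) 1 = 0"
proof (rule higher_pderiv_multiple_root)
  have "[:- 1, 1:] dvd (1 - monom 1 (Suc k) :: real poly)"
    by (subst poly_eq_0_iff_dvd[symmetric]) (simp add: poly_monom)
  then show "[:- 1, 1:] ^ Suc k dvd hermite_basis k s"
    unfolding hermite_basis_def by (intro dvd_mult dvd_power_same)
qed (use assms in simp)

lemma hermite_basis_at_0:
  assumes "j \<le> k"
  shows "poly ((pderiv ^^ j) (hermite_basis k s)) 0 = (if j = s then 1 else 0)"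
proof -
  let ?X = "monom 1 (Suc k) :: real poly" and ?c = "monom (1 / fact s) s :: real poly"
  have X: "[:- 0, 1:] ^ Suc k = ?X"
    by (simp add: monom_altdef)
  have "(1 - ?X) - 1 dvd (1 - ?X) ^ Suc k - 1"
    by (metis dvd_triv_left power_diff_1_eq)
  then have "?X dvd (1 - ?X) ^ Suc k - 1" by simp
  then have "?X dvd ?c * ((1 - ?X) ^ Suc k - 1)" by (rule dvd_mult)
  then have "[:- 0, 1:] ^ Suc k dvd hermite_basis k s - ?c"
    unfolding X hermite_basis_def by (simp only: right_diff_distrib mult_1_right)
  then have "poly ((pderiv ^^ j) (hermite_basis k s - ?c)) 0 = 0"
    by (rule higher_pderiv_multiple_root) (use assms in simp)
  then have "coeff (hermite_basis k s) j = coeff ?c j"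
    unfolding poly_higher_pderiv_0 by simp
  then show ?thesis
    unfolding poly_higher_pderiv_0 by simp
qed

text \<open>
  The polynomial is \<open>\<Sum>\<^sub>s r\<^sub>s h\<^sup>s \<psi>\<^sub>s ((\<xi> - y) / h)\<close> in terms of the basis polynomials \<open>\<psi>\<^sub>s\<close>.
  Each derivative costs one factor \<open>1 / h\<close>, which produces the powers of \<open>h\<close> in the estimate; the
  constant \<open>M\<close> only bounds the derivatives of the \<open>\<psi>\<^sub>s\<close> on \<open>{0..1}\<close> and so does not depend on \<open>y\<close>, \<open>h\<close>, \<open>r\<close>.
\<close>

lemma hermite_interpolation:
  obtains M where "M \<ge> 0" "\<And>y h r. h \<noteq> 0 \<Longrightarrow> \<exists>D :: real poly.
     (\<forall>j\<le>k. poly ((pderiv ^^ j) D) y = r j) \<and> (\<forall>j\<le>k. poly ((pderiv ^^ j) D) (y + h) = 0) \<and>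
     (\<forall>z\<in>{0..1}. \<bar>poly ((pderiv ^^ Suc k) D) (y + h * z)\<bar> \<le> M * (\<Sum>s\<le>k. \<bar>r s\<bar> * \<bar>h\<bar> ^ s) / \<bar>h\<bar> ^ Suc k)"
proof -
  have "\<exists>B. \<forall>z\<in>{0..1}. \<bar>poly ((pderiv ^^ Suc k) (hermite_basis k s)) z\<bar> \<le> B" for s
  proof -
    have "compact ((\<lambda>z. poly ((pderiv ^^ Suc k) (hermite_basis k s)) z) ` {0..1})"
      by (intro compact_continuous_image continuous_intros compact_Icc)
    then have "bounded ((\<lambda>z. poly ((pderiv ^^ Suc k) (hermite_basis k s)) z) ` {0..1})"
      by (rule compact_imp_bounded)
    then show ?thesis by (auto simp: bounded_iff)
  qed
  then obtain B where B: "\<And>s z. z \<in> {0..1} \<Longrightarrow> \<bar>poly ((pderiv ^^ Suc k) (hermite_basis k s)) z\<bar> \<le> B s"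
    by metis
  define M where "M = (\<Sum>s\<le>k. \<bar>B s\<bar>)"
  have BM: "B s \<le> M" if "s \<le> k" for s
    using member_le_sum[of s "{..k}" "\<lambda>s. \<bar>B s\<bar>"] that by (simp add: M_def)
  show ?thesis
  proof (rule that[of M])
    show "M \<ge> 0" by (simp add: M_def sum_nonneg)
    fix y h :: real and r :: "nat \<Rightarrow> real" assume h: "h \<noteq> 0"
    define D where "D = (\<Sum>s\<le>k. smult (r s * h ^ s) (pcompose (hermite_basis k s) [:- y / h, 1 / h:]))"
    have deriv_D: "poly ((pderiv ^^ j) D) (y + h * z)
        = (\<Sum>s\<le>k. r s * h ^ s * (poly ((pderiv ^^ j) (hermite_basis k s)) z / h ^ j))" for j z
    proof -
      have "- y / h + (y + h * z) * (1 / h) = z" using h by (simp add: field_simps)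
      then show ?thesis
        by (simp add: D_def higher_pderiv_sum higher_pderiv_smult higher_pderiv_pcompose_linear
            poly_sum poly_pcompose power_one_over algebra_simps)
    qed
    show "\<exists>D. (\<forall>j\<le>k. poly ((pderiv ^^ j) D) y = r j) \<and> (\<forall>j\<le>k. poly ((pderiv ^^ j) D) (y + h) = 0) \<and>
     (\<forall>z\<in>{0..1}. \<bar>poly ((pderiv ^^ Suc k) D) (y + h * z)\<bar> \<le> M * (\<Sum>s\<le>k. \<bar>r s\<bar> * \<bar>h\<bar> ^ s) / \<bar>h\<bar> ^ Suc k)"
    proof (intro exI[of _ D] conjI allI impI ballI)
      fix j assume j: "j \<le> k"
      show "poly ((pderiv ^^ j) D) y = r j"
      proof -
        have "(\<Sum>s\<le>k. r s * h ^ s * (poly ((pderiv ^^ j) (hermite_basis k s)) 0 / h ^ j))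
            = (\<Sum>s\<le>k. if s = j then r s else 0)"
          using h j by (intro sum.cong) (auto simp: hermite_basis_at_0)
        then show ?thesis using deriv_D[of j 0] j by simp
      qed
      show "poly ((pderiv ^^ j) D) (y + h) = 0"
        using deriv_D[of j 1] j by (simp add: hermite_basis_at_1)
    next
      fix z :: real assume z: "z \<in> {0..1}"
      have "\<bar>poly ((pderiv ^^ Suc k) D) (y + h * z)\<bar>
        \<le> (\<Sum>s\<le>k. \<bar>r s * h ^ s * (poly ((pderiv ^^ Suc k) (hermite_basis k s)) z / h ^ Suc k)\<bar>)"
        unfolding deriv_D by (rule sum_abs)
      also have "\<dots> \<le> (\<Sum>s\<le>k. \<bar>r s\<bar> * \<bar>h\<bar> ^ s * (M / \<bar>h\<bar> ^ Suc k))"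
      proof (rule sum_mono)
        fix s assume "s \<in> {..k}"
        then have "\<bar>poly ((pderiv ^^ Suc k) (hermite_basis k s)) z\<bar> \<le> M"
          using B[OF z, of s] BM[of s] by simp
        then show "\<bar>r s * h ^ s * (poly ((pderiv ^^ Suc k) (hermite_basis k s)) z / h ^ Suc k)\<bar>
            \<le> \<bar>r s\<bar> * \<bar>h\<bar> ^ s * (M / \<bar>h\<bar> ^ Suc k)"
          unfolding abs_mult abs_divide power_abs
          by (intro mult_left_mono divide_right_mono) auto
      qed
      also have "\<dots> = M * (\<Sum>s\<le>k. \<bar>r s\<bar> * \<bar>h\<bar> ^ s) / \<bar>h\<bar> ^ Suc k"
        by (simp add: sum_distrib_left sum_distrib_right sum_divide_distrib mult_ac)
      finally show "\<bar>poly ((pderiv ^^ Suc k) D) (y + h * z)\<bar> \<le> M * (\<Sum>s\<le>k. \<bar>r s\<bar> * \<bar>h\<bar> ^ s) / \<bar>h\<bar> ^ Suc k" .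
    qed
  qed
qed

section \<open>Horizontal curves from polynomials\<close>

lemma euclidean_jet_dist_le_sum_abs:
  "euclidean_jet_dist k p q \<le> \<bar>fst p - fst q\<bar> + (\<Sum>s\<le>k. \<bar>snd p s - snd q s\<bar>)"
proof -
  have "euclidean_jet_dist k p q = sqrt ((fst p - fst q)\<^sup>2 + (L2_set (\<lambda>s. snd p s - snd q s) {..k})\<^sup>2)"
    by (simp add: euclidean_jet_dist_def L2_set_def sum_nonneg)
  also have "\<dots> \<le> \<bar>fst p - fst q\<bar> + \<bar>L2_set (\<lambda>s. snd p s - snd q s) {..k}\<bar>"
    by (rule sqrt_sum_squares_le_sum_abs)
  also have "\<dots> \<le> \<bar>fst p - fst q\<bar> + (\<Sum>s\<le>k. \<bar>snd p s - snd q s\<bar>)"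
    using L2_set_le_sum_abs[of "\<lambda>s. snd p s - snd q s" "{..k}"] by simp
  finally show ?thesis .
qed

lemma absolutely_continuous_curve_lipschitz:
  assumes "\<And>\<sigma> \<tau>. \<sigma> \<in> {a..b} \<Longrightarrow> \<tau> \<in> {a..b} \<Longrightarrow> \<bar>fst (\<gamma> \<sigma>) - fst (\<gamma> \<tau>)\<bar> \<le> L * \<bar>\<sigma> - \<tau>\<bar>"
    and "\<And>s \<sigma> \<tau>. s \<le> k \<Longrightarrow> \<sigma> \<in> {a..b} \<Longrightarrow> \<tau> \<in> {a..b} \<Longrightarrow>
      \<bar>snd (\<gamma> \<sigma>) s - snd (\<gamma> \<tau>) s\<bar> \<le> L * \<bar>\<sigma> - \<tau>\<bar>"
    and "L \<ge> 0"
  shows "absolutely_continuous_curve k \<gamma> a b"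
  unfolding absolutely_continuous_curve_def
proof (intro allI impI)
  fix \<epsilon> :: real assume "\<epsilon> > 0"
  define C where "C = (real k + 2) * L"
  have "C \<ge> 0" using assms(3) by (simp add: C_def)
  have dist: "euclidean_jet_dist k (\<gamma> \<sigma>) (\<gamma> \<tau>) \<le> C * \<bar>\<sigma> - \<tau>\<bar>" if "\<sigma> \<in> {a..b}" "\<tau> \<in> {a..b}" for \<sigma> \<tau>
  proof -
    have "(\<Sum>s\<le>k. \<bar>snd (\<gamma> \<sigma>) s - snd (\<gamma> \<tau>) s\<bar>) \<le> (\<Sum>s\<le>k. L * \<bar>\<sigma> - \<tau>\<bar>)"
      using assms(2) that by (intro sum_mono) auto
    then show ?thesis
      using euclidean_jet_dist_le_sum_abs[of k "\<gamma> \<sigma>" "\<gamma> \<tau>"] assms(1)[OF that]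
      by (simp add: C_def algebra_simps)
  qed
  show "\<exists>\<delta>>0. \<forall>(n::nat) l r.
        (\<forall>i<n. a \<le> l i \<and> l i \<le> r i \<and> r i \<le> b) \<and>
        disjoint_family_on (\<lambda>i. {l i<..<r i}) {..<n} \<and> (\<Sum>i<n. r i - l i) < \<delta>
        \<longrightarrow> (\<Sum>i<n. euclidean_jet_dist k (\<gamma> (l i)) (\<gamma> (r i))) < \<epsilon>"
  proof (intro exI[of _ "\<epsilon> / (C + 1)"] conjI allI impI)
    show "\<epsilon> / (C + 1) > 0" using \<open>\<epsilon> > 0\<close> \<open>C \<ge> 0\<close> by simp
    fix n :: nat and l r
    assume *: "(\<forall>i<n. a \<le> l i \<and> l i \<le> r i \<and> r i \<le> b) \<and>
        disjoint_family_on (\<lambda>i. {l i<..<r i}) {..<n} \<and> (\<Sum>i<n. r i - l i) < \<epsilon> / (C + 1)"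
    have "(\<Sum>i<n. euclidean_jet_dist k (\<gamma> (l i)) (\<gamma> (r i))) \<le> (\<Sum>i<n. C * (r i - l i))"
    proof (rule sum_mono)
      fix i assume "i \<in> {..<n}"
      then have "a \<le> l i" "l i \<le> r i" "r i \<le> b" using * by auto
      then show "euclidean_jet_dist k (\<gamma> (l i)) (\<gamma> (r i)) \<le> C * (r i - l i)"
        using dist[of "l i" "r i"] by (simp add: abs_minus_commute[of "l i"])
    qed
    also have "\<dots> = C * (\<Sum>i<n. r i - l i)" by (simp add: sum_distrib_left)
    also have "\<dots> \<le> C * (\<epsilon> / (C + 1))"
      using * \<open>C \<ge> 0\<close> by (intro mult_left_mono) auto
    also have "\<dots> < \<epsilon>" using \<open>\<epsilon> > 0\<close> \<open>C \<ge> 0\<close> by (simp add: field_simps)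
    finally show "(\<Sum>i<n. euclidean_jet_dist k (\<gamma> (l i)) (\<gamma> (r i))) < \<epsilon>" .
  qed
qed

lemma has_velocity_imp_velocity: "has_velocity \<gamma> v \<tau> \<Longrightarrow> velocity \<gamma> \<tau> = v"
  by (auto simp: has_velocity_def velocity_def DERIV_imp_deriv intro!: prod_eqI)

text \<open>
  Either the speed is integrable and the bound follows by monotonicity, or its integral is 0 by
  convention.
\<close>

lemma cc_length_le:
  assumes "a < b" "B \<ge> 0" "finite S"
    and vel: "\<And>\<tau>. \<tau> \<in> {a<..<b} - S \<Longrightarrow>
      \<exists>\<alpha> \<beta>. has_velocity \<gamma> (frame_comb k (\<gamma> \<tau>) \<alpha> \<beta>) \<tau> \<and> sqrt (\<alpha>\<^sup>2 + \<beta>\<^sup>2) \<le> B"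
  shows "cc_length k \<gamma> a b \<le> B * (b - a)"
proof -
  let ?F = "\<lambda>\<tau>. indicator {a..b} \<tau> *\<^sub>R horizontal_norm k (\<gamma> \<tau>) (velocity \<gamma> \<tau>)"
  have "AE \<tau> in lebesgue. \<tau> \<notin> insert a (insert b S)"
    using assms(3) by (intro AE_not_in) (simp add: negligible_iff_null_sets[symmetric] negligible_finite)
  then have bound: "AE \<tau> in lebesgue. ?F \<tau> \<le> indicator {a..b} \<tau> * B"
  proof eventually_elim
    case (elim \<tau>)
    show ?case
    proof (cases "\<tau> \<in> {a..b}")
      case True
      with elim have "\<tau> \<in> {a<..<b} - S" by auto
      from vel[OF this] show ?thesis
        using True by (auto dest!: has_velocity_imp_velocity simp: horizontal_norm_frame_comb)
    qed simp
  qed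
  show ?thesis
  proof (cases "integrable lebesgue ?F")
    case True
    have "integral\<^sup>L lebesgue ?F \<le> (LINT \<tau>|lebesgue. indicator {a..b} \<tau> * B)"
      using assms(1) by (intro integral_mono_AE True bound integrable_mult_left) auto
    also have "\<dots> = B * (b - a)" using assms(1) by simp
    finally show ?thesis by (simp add: cc_length_def set_lebesgue_integral_def)
  next
    case False
    then show ?thesis
      using assms(1,2) by (simp add: cc_length_def set_lebesgue_integral_def not_integrable_integral_eq)
  qed
qed

lemma AE_horizontalI:
  assumes "finite S" "\<And>\<tau>. \<tau> \<in> {a<..<b} - S \<Longrightarrow> \<exists>\<alpha> \<beta>. has_velocity \<gamma> (frame_comb k (\<gamma> \<tau>) \<alpha> \<beta>) \<tau>"
  shows "AE \<tau> in lebesgue. \<tau> \<in> {a<..<b} \<longrightarrow> (\<exists>v \<in> horizontal_space k (\<gamma> \<tau>). has_velocity \<gamma> v \<tau>)"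
proof -
  have "AE \<tau> in lebesgue. \<tau> \<notin> S"
    using assms(1) by (intro AE_not_in) (simp add: negligible_iff_null_sets[symmetric] negligible_finite)
  then show ?thesis
    by eventually_elim (use assms(2) in \<open>unfold horizontal_space_def, blast\<close>)
qed

definition poly_jet :: "nat \<Rightarrow> real poly \<Rightarrow> real \<Rightarrow> jet" where
  "poly_jet k g \<xi> = (\<xi>, \<lambda>s. if s \<le> k then poly ((pderiv ^^ s) g) \<xi> else 0)"

text \<open>
  The jet of a polynomial moves along the horizontal field \<open>X + g\<^sup>(\<^sup>k\<^sup>+\<^sup>1\<^sup>) U\<close>; a curve
  that runs through it with \<open>x' = c\<close> has \<open>c\<close> times this velocity.
\<close>

lemma poly_jet_has_velocity:
  assumes "(\<xi> has_real_derivative c) (at \<tau>)"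
  shows "has_velocity (\<lambda>\<sigma>. poly_jet k g (\<xi> \<sigma>))
     (frame_comb k (poly_jet k g (\<xi> \<tau>)) c (c * poly ((pderiv ^^ Suc k) g) (\<xi> \<tau>))) \<tau>"
proof -
  have "((\<lambda>\<sigma>. poly ((pderiv ^^ s) g) (\<xi> \<sigma>)) has_real_derivative poly ((pderiv ^^ Suc s) g) (\<xi> \<tau>) * c) (at \<tau>)" for s
    using DERIV_chain2[OF poly_DERIV assms, of "(pderiv ^^ s) g"] by simp
  then show ?thesis
    using assms unfolding has_velocity_def poly_jet_def frame_comb_def field_X_def field_U_def
    by (auto simp: mult.commute not_less)
qed

lemma has_velocity_transform:
  assumes "has_velocity \<gamma> v \<tau>" "open S" "\<tau> \<in> S" "\<And>\<sigma>. \<sigma> \<in> S \<Longrightarrow> \<gamma> \<sigma> = \<gamma>' \<sigma>"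
  shows "has_velocity \<gamma>' v \<tau>"
  unfolding has_velocity_def
proof (intro conjI allI)
  show "((\<lambda>\<sigma>. fst (\<gamma>' \<sigma>)) has_real_derivative fst v) (at \<tau>)"
    by (rule has_field_derivative_transform_within_open[of "\<lambda>\<sigma>. fst (\<gamma> \<sigma>)"])
      (use assms in \<open>auto simp: has_velocity_def\<close>)
  show "((\<lambda>\<sigma>. snd (\<gamma>' \<sigma>) s) has_real_derivative snd v s) (at \<tau>)" for s
    by (rule has_field_derivative_transform_within_open[of "\<lambda>\<sigma>. snd (\<gamma> \<sigma>) s"])
      (use assms in \<open>auto simp: has_velocity_def\<close>)
qed

lemma poly_affine_lipschitz:
  fixes p :: "real poly"
  shows "\<exists>L. L-lipschitz_on {a..b} (\<lambda>\<sigma>. poly p (x + h * \<sigma>))"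
proof -
  let ?q = "pcompose p [:x, h:]"
  have "compact ((\<lambda>z. poly (pderiv ?q) z) ` {a..b})"
    by (intro compact_continuous_image continuous_intros compact_Icc)
  then have "\<exists>B. \<forall>z\<in>{a..b}. \<bar>poly (pderiv ?q) z\<bar> \<le> B"
    by (auto dest!: compact_imp_bounded simp: bounded_iff)
  then obtain B where B: "\<And>z. z \<in> {a..b} \<Longrightarrow> \<bar>poly (pderiv ?q) z\<bar> \<le> B" by blast
  have "(max B 0)-lipschitz_on {a..b} (poly ?q)"
  proof (rule bounded_derivative_imp_lipschitz[where f' = "\<lambda>z. (*) (poly (pderiv ?q) z)"])
    show "(poly ?q has_derivative (*) (poly (pderiv ?q) z)) (at z within {a..b})" for z
      using poly_DERIV[of ?q z] unfolding has_field_derivative_def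
      by (rule has_derivative_at_withinI)
    show "onorm ((*) (poly (pderiv ?q) z)) \<le> max B 0" if "z \<in> {a..b}" for z
      by (rule onorm_le) (use B[OF that] in \<open>auto simp: abs_mult intro!: mult_right_mono\<close>)
  qed auto
  then show ?thesis by (auto simp: poly_pcompose mult.commute)
qed

text \<open>
  The curve runs through the jets of \<open>g1\<close> from \<open>x\<close> to \<open>x + h1\<close> during \<open>{0..1}\<close>, and backwards through
  the jets of \<open>g2\<close> from \<open>y + h2\<close> to \<open>y\<close> during \<open>{1..2}\<close>. At time 1, where the two
  pieces meet, the velocity may jump, but their Lipschitz bounds combine.
\<close>

lemma two_piece_curve:
  assumes meet: "poly_jet k g1 (x + h1) = poly_jet k g2 (y + h2)"
    and "B \<ge> 0"
    and b1: "\<And>z. z \<in> {0..1} \<Longrightarrow> \<bar>h1\<bar> * (1 + \<bar>poly ((pderiv ^^ Suc k) g1) (x + h1 * z)\<bar>) \<le> B"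
    and b2: "\<And>z. z \<in> {0..1} \<Longrightarrow> \<bar>h2\<bar> * (1 + \<bar>poly ((pderiv ^^ Suc k) g2) (y + h2 * z)\<bar>) \<le> B"
  shows "\<exists>\<gamma>. horizontal_curve k \<gamma> 0 2 \<and> \<gamma> 0 = poly_jet k g1 x \<and> \<gamma> 2 = poly_jet k g2 y \<and>
     cc_length k \<gamma> 0 2 \<le> 2 * B"
proof -
  define c1 where "c1 \<sigma> = poly_jet k g1 (x + h1 * \<sigma>)" for \<sigma>
  define c2 where "c2 \<sigma> = poly_jet k g2 ((y + h2 * 2) + - h2 * \<sigma>)" for \<sigma>
  define \<gamma> where "\<gamma> \<sigma> = (if \<sigma> \<le> 1 then c1 \<sigma> else c2 \<sigma>)" for \<sigma>
  have c12: "c1 1 = c2 1" using meet by (simp add: c1_def c2_def algebra_simps)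
  have speed: "sqrt (h\<^sup>2 + (h * w)\<^sup>2) \<le> \<bar>h\<bar> * (1 + \<bar>w\<bar>)" for h w :: real
    using sqrt_sum_squares_le_sum_abs[of h "h * w"] by (simp add: abs_mult algebra_simps)
  have vel: "\<exists>\<alpha> \<beta>. has_velocity \<gamma> (frame_comb k (\<gamma> \<tau>) \<alpha> \<beta>) \<tau> \<and> sqrt (\<alpha>\<^sup>2 + \<beta>\<^sup>2) \<le> B"
    if \<tau>: "\<tau> \<in> {0<..<2} - {1}" for \<tau>
  proof (cases "\<tau> < 1")
    case True
    let ?w = "poly ((pderiv ^^ Suc k) g1) (x + h1 * \<tau>)"
    have v: "has_velocity c1 (frame_comb k (c1 \<tau>) h1 (h1 * ?w)) \<tau>"
      unfolding c1_def by (rule poly_jet_has_velocity) (auto intro!: derivative_eq_intros)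
    have eq: "\<gamma> \<tau> = c1 \<tau>" using True by (simp add: \<gamma>_def)
    have "has_velocity \<gamma> (frame_comb k (\<gamma> \<tau>) h1 (h1 * ?w)) \<tau>"
      unfolding eq by (rule has_velocity_transform[OF v, of "{..<1}"]) (use True in \<open>auto simp: \<gamma>_def\<close>)
    moreover have "sqrt (h1\<^sup>2 + (h1 * ?w)\<^sup>2) \<le> B"
      using speed[of h1 ?w] b1[of \<tau>] True \<tau> by auto
    ultimately show ?thesis by blast
  next
    case False
    let ?w = "poly ((pderiv ^^ Suc k) g2) ((y + h2 * 2) + - h2 * \<tau>)"
    have v: "has_velocity c2 (frame_comb k (c2 \<tau>) (- h2) (- h2 * ?w)) \<tau>"
      unfolding c2_def by (rule poly_jet_has_velocity) (auto intro!: derivative_eq_intros)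
    have eq: "\<gamma> \<tau> = c2 \<tau>" using False \<tau> by (simp add: \<gamma>_def)
    have "has_velocity \<gamma> (frame_comb k (\<gamma> \<tau>) (- h2) (- h2 * ?w)) \<tau>"
      unfolding eq by (rule has_velocity_transform[OF v, of "{1<..}"]) (use False \<tau> in \<open>auto simp: \<gamma>_def\<close>)
    moreover have "sqrt ((- h2)\<^sup>2 + (- h2 * ?w)\<^sup>2) \<le> B"
    proof -
      have "y + h2 * 2 + - h2 * \<tau> = y + h2 * (2 - \<tau>)" by (simp add: algebra_simps)
      then have "\<bar>- h2\<bar> * (1 + \<bar>?w\<bar>) \<le> B"
        using b2[of "2 - \<tau>"] False \<tau> by (simp only:) auto
      with speed[of "- h2" ?w] show ?thesis by (rule order_trans)
    qed
    ultimately show ?thesis by blast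
  qed
  have lip_coord: "\<exists>L. L-lipschitz_on {0..2} (\<lambda>\<sigma>. snd (\<gamma> \<sigma>) s)" for s
  proof (cases "s \<le> k")
    case True
    obtain L1 where L1: "L1-lipschitz_on {0..1} (\<lambda>\<sigma>. snd (c1 \<sigma>) s)"
      using poly_affine_lipschitz[of 0 1 "(pderiv ^^ s) g1" x h1] True by (auto simp: c1_def poly_jet_def)
    obtain L2 where L2: "L2-lipschitz_on {1..2} (\<lambda>\<sigma>. snd (c2 \<sigma>) s)"
      using poly_affine_lipschitz[of 1 2 "(pderiv ^^ s) g2" "y + h2 * 2" "- h2"] True
      by (auto simp: c2_def poly_jet_def)
    have "(max L1 L2)-lipschitz_on {0..2} (\<lambda>\<sigma>. if \<sigma> \<le> 1 then snd (c1 \<sigma>) s else snd (c2 \<sigma>) s)"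
      using c12 by (intro lipschitz_on_concat_max L1 L2) simp
    then show ?thesis by (auto simp: \<gamma>_def if_distrib[of snd] if_distribR)
  next
    case False
    then have "snd (\<gamma> \<sigma>) s = 0" for \<sigma> by (simp add: \<gamma>_def c1_def c2_def poly_jet_def)
    then show ?thesis by (auto intro!: exI[of _ 0] simp: lipschitz_on_def)
  qed
  then obtain L where L: "\<And>s. (L s)-lipschitz_on {0..2} (\<lambda>\<sigma>. snd (\<gamma> \<sigma>) s)" by metis
  have "\<exists>L0. L0-lipschitz_on {0..2} (\<lambda>\<sigma>. fst (\<gamma> \<sigma>))"
  proof -
    have "\<exists>L. L-lipschitz_on {0..1} (\<lambda>\<sigma>. fst (c1 \<sigma>))"
      using poly_affine_lipschitz[of 0 1 "[:0,1:]" x h1] by (auto simp: c1_def poly_jet_def)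
    then obtain L1 where L1: "L1-lipschitz_on {0..1} (\<lambda>\<sigma>. fst (c1 \<sigma>))" by blast
    have "\<exists>L. L-lipschitz_on {1..2} (\<lambda>\<sigma>. fst (c2 \<sigma>))"
      using poly_affine_lipschitz[of 1 2 "[:0,1:]" "y + h2 * 2" "- h2"] by (auto simp: c2_def poly_jet_def)
    then obtain L2 where L2: "L2-lipschitz_on {1..2} (\<lambda>\<sigma>. fst (c2 \<sigma>))" by blast
    have "(max L1 L2)-lipschitz_on {0..2} (\<lambda>\<sigma>. if \<sigma> \<le> 1 then fst (c1 \<sigma>) else fst (c2 \<sigma>))"
      using c12 by (intro lipschitz_on_concat_max L1 L2) simp
    then show ?thesis by (auto simp: \<gamma>_def if_distrib[of fst])
  qed
  then obtain L0 where L0: "L0-lipschitz_on {0..2} (\<lambda>\<sigma>. fst (\<gamma> \<sigma>))" by blast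
  define \<Lambda> where "\<Lambda> = L0 + (\<Sum>s\<le>k. L s)"
  have Lnn: "L0 \<ge> 0" "L s \<ge> 0" for s using L0 L lipschitz_on_nonneg by blast+
  have \<Lambda>: "L0 \<le> \<Lambda>" "s \<le> k \<Longrightarrow> L s \<le> \<Lambda>" for s
    using Lnn member_le_sum[of s "{..k}" L] by (auto simp: \<Lambda>_def sum_nonneg intro: add_increasing)
  have "horizontal_curve k \<gamma> 0 2"
    unfolding horizontal_curve_def
  proof (intro conjI)
    show "\<gamma> ` {0..2} \<subseteq> jet_space k"
      by (auto simp: jet_space_def \<gamma>_def c1_def c2_def poly_jet_def)
    show "absolutely_continuous_curve k \<gamma> 0 2"
    proof (rule absolutely_continuous_curve_lipschitz)
      fix \<sigma> \<tau> :: real assume st: "\<sigma> \<in> {0..2}" "\<tau> \<in> {0..2}"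
      show "\<bar>fst (\<gamma> \<sigma>) - fst (\<gamma> \<tau>)\<bar> \<le> \<Lambda> * \<bar>\<sigma> - \<tau>\<bar>"
        using lipschitz_onD[OF lipschitz_on_mono[OF L0 order_refl \<Lambda>(1)] st] by (simp add: dist_real_def)
      show "\<bar>snd (\<gamma> \<sigma>) s - snd (\<gamma> \<tau>) s\<bar> \<le> \<Lambda> * \<bar>\<sigma> - \<tau>\<bar>" if "s \<le> k" for s
        using lipschitz_onD[OF lipschitz_on_mono[OF L order_refl \<Lambda>(2)[OF that]] st] by (simp add: dist_real_def)
    qed (use \<Lambda>(1) Lnn(1) in linarith)
    show "AE \<tau> in lebesgue. \<tau> \<in> {0<..<2} \<longrightarrow> (\<exists>v \<in> horizontal_space k (\<gamma> \<tau>). has_velocity \<gamma> v \<tau>)"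
      by (rule AE_horizontalI[of "{1}"]) (use vel in blast)+
  qed
  moreover have "cc_length k \<gamma> 0 2 \<le> B * (2 - 0)"
    by (rule cc_length_le[of 0 2 B "{1}"]) (use vel \<open>B \<ge> 0\<close> in auto)
  moreover have "\<gamma> 0 = poly_jet k g1 x" "\<gamma> 2 = poly_jet k g2 y"
    by (simp_all add: \<gamma>_def c1_def c2_def)
  ultimately show ?thesis by (intro exI[of _ \<gamma>]) auto
qed

lemma poly_jet_eqI:
  assumes "p \<in> jet_space k" "\<And>j. j \<le> k \<Longrightarrow> poly ((pderiv ^^ j) g) (fst p) = snd p j"
  shows "poly_jet k g (fst p) = p"
  using assms by (auto simp: poly_jet_def jet_space_def intro!: prod_eqI)

text \<open>
  This serves two purposes. Any two jets are joined by a horizontal curve, so the infimum that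
  defines the distance is never taken over the empty set. If moreover the two points have the same
  first coordinate, both pieces have displacement \<open>h\<close> and the data that \<open>D\<close> interpolates are exactly
  the differences of the coordinates, which therefore control the length.
\<close>

lemma connecting_curve:
  obtains M where "M \<ge> 0" "\<And>p q h. p \<in> jet_space k \<Longrightarrow> q \<in> jet_space k \<Longrightarrow> h \<noteq> 0 \<Longrightarrow>
    \<exists>\<gamma>. horizontal_curve k \<gamma> 0 2 \<and> \<gamma> 0 = p \<and> \<gamma> 2 = q \<and>
      (fst p = fst q \<longrightarrow> cc_length k \<gamma> 0 2
          \<le> 2 * (\<bar>h\<bar> * (1 + M * (\<Sum>s\<le>k. \<bar>snd q s - snd p s\<bar> * \<bar>h\<bar> ^ s) / \<bar>h\<bar> ^ Suc k)))"
proof -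
  obtain M where "M \<ge> 0" and M: "\<And>y h r. h \<noteq> 0 \<Longrightarrow> \<exists>D :: real poly.
     (\<forall>j\<le>k. poly ((pderiv ^^ j) D) y = r j) \<and> (\<forall>j\<le>k. poly ((pderiv ^^ j) D) (y + h) = 0) \<and>
     (\<forall>z\<in>{0..1}. \<bar>poly ((pderiv ^^ Suc k) D) (y + h * z)\<bar> \<le> M * (\<Sum>s\<le>k. \<bar>r s\<bar> * \<bar>h\<bar> ^ s) / \<bar>h\<bar> ^ Suc k)"
    using hermite_interpolation[of k] by blast
  show ?thesis
  proof (rule that[OF \<open>M \<ge> 0\<close>])
    fix p q :: jet and h :: real
    assume p: "p \<in> jet_space k" and q: "q \<in> jet_space k" and h: "h \<noteq> 0"
    let ?x = "fst p" and ?y = "fst q"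
    obtain g1 where g1: "\<And>j. j \<le> k \<Longrightarrow> poly ((pderiv ^^ j) g1) ?x = snd p j" "(pderiv ^^ Suc k) g1 = 0"
      using taylor_polynomial[of k ?x "snd p"] by blast
    \<comment> \<open>The defect of \<open>g1\<close> at the base point of \<open>q\<close>, which \<open>D\<close> has to repair.\<close>
    define r where "r j = snd q j - poly ((pderiv ^^ j) g1) ?y" for j
    define E where "E = M * (\<Sum>s\<le>k. \<bar>r s\<bar> * \<bar>h\<bar> ^ s) / \<bar>h\<bar> ^ Suc k"
    have "E \<ge> 0" unfolding E_def using \<open>M \<ge> 0\<close>
      by (intro divide_nonneg_nonneg mult_nonneg_nonneg sum_nonneg) auto
    from M[OF h, of ?y r] obtain D where D: "\<And>j. j \<le> k \<Longrightarrow> poly ((pderiv ^^ j) D) ?y = r j"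
      "\<And>j. j \<le> k \<Longrightarrow> poly ((pderiv ^^ j) D) (?y + h) = 0"
      "\<And>z. z \<in> {0..1} \<Longrightarrow> \<bar>poly ((pderiv ^^ Suc k) D) (?y + h * z)\<bar> \<le> E"
      unfolding E_def by blast
    \<comment> \<open>The first piece must end over the point \<open>?y + h\<close> where the second one starts.\<close>
    define h1 where "h1 = ?y + h - ?x"
    define B where "B = max \<bar>h1\<bar> (\<bar>h\<bar> * (1 + E))"
    have "\<exists>\<gamma>. horizontal_curve k \<gamma> 0 2 \<and> \<gamma> 0 = poly_jet k g1 ?x \<and> \<gamma> 2 = poly_jet k (g1 + D) ?y \<and>
      cc_length k \<gamma> 0 2 \<le> 2 * B"
    proof (rule two_piece_curve)
      show "poly_jet k g1 (?x + h1) = poly_jet k (g1 + D) (?y + h)"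
        using D(2) by (auto simp: h1_def poly_jet_def higher_pderiv_add)
      show "B \<ge> 0" by (simp add: B_def)
      show "\<bar>h1\<bar> * (1 + \<bar>poly ((pderiv ^^ Suc k) g1) (?x + h1 * z)\<bar>) \<le> B" for z
        unfolding g1(2) by (simp add: B_def)
      fix z :: real assume z: "z \<in> {0..1}"
      have "\<bar>poly ((pderiv ^^ Suc k) (g1 + D)) (?y + h * z)\<bar> \<le> E"
        unfolding higher_pderiv_add g1(2) using D(3)[OF z] by simp
      then have "\<bar>h\<bar> * (1 + \<bar>poly ((pderiv ^^ Suc k) (g1 + D)) (?y + h * z)\<bar>) \<le> \<bar>h\<bar> * (1 + E)"
        by (intro mult_left_mono) auto
      then show "\<bar>h\<bar> * (1 + \<bar>poly ((pderiv ^^ Suc k) (g1 + D)) (?y + h * z)\<bar>) \<le> B"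
        by (simp add: B_def)
    qed
    moreover have "poly_jet k g1 ?x = p" using p g1(1) by (rule poly_jet_eqI)
    moreover have "poly_jet k (g1 + D) ?y = q"
      using q by (rule poly_jet_eqI) (simp add: higher_pderiv_add D(1) r_def)
    ultimately obtain \<gamma> where \<gamma>: "horizontal_curve k \<gamma> 0 2" "\<gamma> 0 = p" "\<gamma> 2 = q"
      "cc_length k \<gamma> 0 2 \<le> 2 * B" by auto
    have "B = \<bar>h\<bar> * (1 + M * (\<Sum>s\<le>k. \<bar>snd q s - snd p s\<bar> * \<bar>h\<bar> ^ s) / \<bar>h\<bar> ^ Suc k)" if "?x = ?y"
    proof -
      have "(\<Sum>s\<le>k. \<bar>r s\<bar> * \<bar>h\<bar> ^ s) = (\<Sum>s\<le>k. \<bar>snd q s - snd p s\<bar> * \<bar>h\<bar> ^ s)"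
        using g1(1) that by (intro sum.cong) (auto simp: r_def)
      then have "E = M * (\<Sum>s\<le>k. \<bar>snd q s - snd p s\<bar> * \<bar>h\<bar> ^ s) / \<bar>h\<bar> ^ Suc k"
        by (simp add: E_def)
      moreover have "B = \<bar>h\<bar> * (1 + E)"
        using \<open>E \<ge> 0\<close> that by (simp add: B_def h1_def max_def algebra_simps)
      ultimately show ?thesis by simp
    qed
    then show "\<exists>\<gamma>. horizontal_curve k \<gamma> 0 2 \<and> \<gamma> 0 = p \<and> \<gamma> 2 = q \<and>
      (fst p = fst q \<longrightarrow> cc_length k \<gamma> 0 2
          \<le> 2 * (\<bar>h\<bar> * (1 + M * (\<Sum>s\<le>k. \<bar>snd q s - snd p s\<bar> * \<bar>h\<bar> ^ s) / \<bar>h\<bar> ^ Suc k)))"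
      using \<gamma> by (intro exI[of _ \<gamma>]) auto
  qed
qed

section \<open>Upper bounds for the distance\<close>

lemma cc_length_nonneg:
  assumes "horizontal_curve k \<gamma> a b"
  shows "cc_length k \<gamma> a b \<ge> 0"
proof -
  have "AE \<tau> in lebesgue. \<tau> \<notin> {a, b}"
    by (intro AE_not_in) (simp add: negligible_iff_null_sets[symmetric] negligible_finite)
  moreover have "AE \<tau> in lebesgue. \<tau> \<in> {a<..<b} \<longrightarrow> (\<exists>v \<in> horizontal_space k (\<gamma> \<tau>). has_velocity \<gamma> v \<tau>)"
    using assms by (simp add: horizontal_curve_def)
  ultimately have "AE \<tau> in lebesgue. 0 \<le> indicator {a..b} \<tau> *\<^sub>R horizontal_norm k (\<gamma> \<tau>) (velocity \<gamma> \<tau>)"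
  proof eventually_elim
    case (elim \<tau>)
    show ?case
    proof (cases "\<tau> \<in> {a..b}")
      case True
      with elim obtain v where v: "v \<in> horizontal_space k (\<gamma> \<tau>)" "has_velocity \<gamma> v \<tau>" by force
      then obtain \<alpha> \<beta> where "velocity \<gamma> \<tau> = frame_comb k (\<gamma> \<tau>) \<alpha> \<beta>"
        using has_velocity_imp_velocity unfolding horizontal_space_def by blast
      then show ?thesis by (simp add: horizontal_norm_frame_comb)
    qed simp
  qed
  then show ?thesis
    unfolding cc_length_def set_lebesgue_integral_def by (rule integral_nonneg_AE)
qed

lemma cc_dist_le_cc_length:
  assumes "a < b" "horizontal_curve k \<gamma> a b" "\<gamma> a = p" "\<gamma> b = q"
  shows "cc_dist k p q \<le> cc_length k \<gamma> a b"
  unfolding cc_dist_def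
proof (rule cInf_lower)
  show "bdd_below {cc_length k \<gamma> a b |\<gamma> a b. a < b \<and> horizontal_curve k \<gamma> a b \<and> \<gamma> a = p \<and> \<gamma> b = q}"
    by (rule bdd_belowI[of _ 0]) (auto simp: cc_length_nonneg)
qed (use assms in blast)

text \<open>
  Lower bounds on lengths pass to the infimum because a connecting curve always exists; the infimum
  of the empty set of reals would be an arbitrary number.
\<close>

lemma cc_dist_greatest:
  assumes "p \<in> jet_space k" "q \<in> jet_space k"
    and "\<And>\<gamma> a b. a < b \<Longrightarrow> horizontal_curve k \<gamma> a b \<Longrightarrow> \<gamma> a = p \<Longrightarrow> \<gamma> b = q \<Longrightarrow> c \<le> cc_length k \<gamma> a b"
  shows "c \<le> cc_dist k p q"
  unfolding cc_dist_def
proof (rule cInf_greatest)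
  obtain \<gamma> where "horizontal_curve k \<gamma> 0 2" "\<gamma> 0 = p" "\<gamma> 2 = q"
    using connecting_curve[of k] assms(1,2) by (metis zero_neq_one)
  then have "cc_length k \<gamma> 0 2 \<in>
      {cc_length k \<gamma> a b |\<gamma> a b. a < b \<and> horizontal_curve k \<gamma> a b \<and> \<gamma> a = p \<and> \<gamma> b = q}"
    by (intro CollectI exI[of _ \<gamma>] exI[of _ 0] exI[of _ 2]) auto
  then show "{cc_length k \<gamma> a b |\<gamma> a b. a < b \<and> horizontal_curve k \<gamma> a b \<and> \<gamma> a = p \<and> \<gamma> b = q} \<noteq> {}"
    by blast
qed (use assms(3) in auto)

lemma cc_dist_nonneg:
  assumes "p \<in> jet_space k" "q \<in> jet_space k"
  shows "cc_dist k p q \<ge> 0"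
  using assms by (rule cc_dist_greatest) (rule cc_length_nonneg)

lemma cc_dist_refl_le:
  assumes "p \<in> jet_space k"
  shows "cc_dist k p p \<le> 0"
proof -
  have vel: "has_velocity (\<lambda>_. p) (frame_comb k p 0 0) \<tau>" for \<tau>
    by (simp add: has_velocity_def frame_comb_def)
  have "horizontal_curve k (\<lambda>_. p) 0 1"
    unfolding horizontal_curve_def
  proof (intro conjI)
    show "absolutely_continuous_curve k (\<lambda>_. p) 0 1"
      by (rule absolutely_continuous_curve_lipschitz[of _ _ _ 0]) auto
    show "AE \<tau> in lebesgue. \<tau> \<in> {0<..<1} \<longrightarrow> (\<exists>v \<in> horizontal_space k p. has_velocity (\<lambda>_. p) v \<tau>)"
      by (rule AE_horizontalI[of "{}"]) (use vel in blast)+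
  qed (use assms in auto)
  then have "cc_dist k p p \<le> cc_length k (\<lambda>_. p) 0 1"
    by (intro cc_dist_le_cc_length) auto
  also have "\<dots> \<le> 0 * (1 - 0)"
    using vel by (intro cc_length_le[of 0 1 0 "{}"]) (auto intro: exI[of _ "0::real"])
  finally show ?thesis by simp
qed

text \<open>
  With \<open>\<rho>\<close> the sum of the coordinate differences, the choice \<open>h = \<rho>\<^sup>1\<^sup>/\<^sup>(\<^sup>k\<^sup>+\<^sup>1\<^sup>)\<close> in
  \<open>connecting_curve\<close> makes \<open>h\<^sup>k\<^sup>+\<^sup>1\<close> equal to \<open>\<rho>\<close>, so the interpolation term stays bounded and the
  length is of order \<open>h\<close>. The bound \<open>R\<close> keeps \<open>h\<close>, and with it the powers \<open>h\<^sup>s\<close>, bounded.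
\<close>

lemma cc_dist_vertical_le:
  assumes "R \<ge> 0"
  obtains C where "C \<ge> 0" "\<And>p q. p \<in> jet_space k \<Longrightarrow> q \<in> jet_space k \<Longrightarrow> fst p = fst q \<Longrightarrow>
    (\<Sum>s\<le>k. \<bar>snd q s - snd p s\<bar>) \<le> R \<Longrightarrow>
    cc_dist k p q \<le> C * (\<Sum>s\<le>k. \<bar>snd q s - snd p s\<bar>) powr (1 / (real k + 1))"
proof -
  obtain M where "M \<ge> 0" and M: "\<And>p q h. p \<in> jet_space k \<Longrightarrow> q \<in> jet_space k \<Longrightarrow> h \<noteq> 0 \<Longrightarrow>
    \<exists>\<gamma>. horizontal_curve k \<gamma> 0 2 \<and> \<gamma> 0 = p \<and> \<gamma> 2 = q \<and>
      (fst p = fst q \<longrightarrow> cc_length k \<gamma> 0 2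
          \<le> 2 * (\<bar>h\<bar> * (1 + M * (\<Sum>s\<le>k. \<bar>snd q s - snd p s\<bar> * \<bar>h\<bar> ^ s) / \<bar>h\<bar> ^ Suc k)))"
    using connecting_curve[of k] by blast
  define H where "H = R powr (1 / (real k + 1))"
  define C where "C = 2 * (1 + M * (\<Sum>s\<le>k. H ^ s))"
  have "H \<ge> 0" by (simp add: H_def)
  show ?thesis
  proof (rule that[of C])
    show "C \<ge> 0" using \<open>M \<ge> 0\<close> \<open>H \<ge> 0\<close> by (simp add: C_def sum_nonneg)
    fix p q :: jet
    assume p: "p \<in> jet_space k" and q: "q \<in> jet_space k" and eq: "fst p = fst q"
      and small: "(\<Sum>s\<le>k. \<bar>snd q s - snd p s\<bar>) \<le> R"
    define \<rho> where "\<rho> = (\<Sum>s\<le>k. \<bar>snd q s - snd p s\<bar>)"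
    define h where "h = \<rho> powr (1 / (real k + 1))"
    have "\<rho> \<ge> 0" by (simp add: \<rho>_def sum_nonneg)
    have le_\<rho>: "\<bar>snd q s - snd p s\<bar> \<le> \<rho>" if "s \<le> k" for s
      unfolding \<rho>_def using that by (intro member_le_sum) auto
    have "cc_dist k p q \<le> C * h"
    proof (cases "\<rho> = 0")
      case True
      have "snd p s = snd q s" for s
      proof (cases "s \<le> k")
        case True
        then show ?thesis using le_\<rho>[OF True] \<open>\<rho> = 0\<close> by simp
      qed (use p q in \<open>auto simp: jet_space_def\<close>)
      then have "p = q" using eq by (auto intro!: prod_eqI)
      then show ?thesis using cc_dist_refl_le[OF p] True by (simp add: h_def)
    next
      case False
      then have "\<rho> > 0" using \<open>\<rho> \<ge> 0\<close> by simp
      then have "h > 0" by (simp add: h_def)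
      have h_pow: "h ^ Suc k = \<rho>"
      proof -
        have "h ^ Suc k = h powr real (Suc k)" using \<open>h > 0\<close> by (simp only: powr_realpow)
        also have "\<dots> = \<rho> powr 1" unfolding h_def powr_powr by (simp add: add.commute)
        finally show ?thesis using \<open>\<rho> > 0\<close> by simp
      qed
      have "h \<le> H"
        unfolding h_def H_def using small \<open>\<rho> \<ge> 0\<close> by (intro powr_mono2) (auto simp: \<rho>_def)
      obtain \<gamma> where \<gamma>: "horizontal_curve k \<gamma> 0 2" "\<gamma> 0 = p" "\<gamma> 2 = q"
        "cc_length k \<gamma> 0 2 \<le> 2 * (h * (1 + M * (\<Sum>s\<le>k. \<bar>snd q s - snd p s\<bar> * h ^ s) / h ^ Suc k))"
        using M[OF p q, of h] eq \<open>h > 0\<close> by auto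
      have "(\<Sum>s\<le>k. \<bar>snd q s - snd p s\<bar> * h ^ s) \<le> (\<Sum>s\<le>k. \<rho> * H ^ s)"
        using le_\<rho> \<open>h \<le> H\<close> \<open>h > 0\<close> \<open>\<rho> \<ge> 0\<close> by (intro sum_mono mult_mono power_mono) auto
      also have "\<dots> = \<rho> * (\<Sum>s\<le>k. H ^ s)" by (simp add: sum_distrib_left)
      finally have "(\<Sum>s\<le>k. \<bar>snd q s - snd p s\<bar> * h ^ s) / \<rho> \<le> (\<Sum>s\<le>k. H ^ s)"
        using \<open>\<rho> > 0\<close> by (simp add: divide_le_eq mult.commute)
      then have "M * ((\<Sum>s\<le>k. \<bar>snd q s - snd p s\<bar> * h ^ s) / \<rho>) \<le> M * (\<Sum>s\<le>k. H ^ s)"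
        using \<open>M \<ge> 0\<close> by (rule mult_left_mono)
      then have "2 * (h * (1 + M * (\<Sum>s\<le>k. \<bar>snd q s - snd p s\<bar> * h ^ s) / h ^ Suc k)) \<le> C * h"
        unfolding h_pow C_def using \<open>h > 0\<close> by simp
      then show ?thesis
        using \<gamma>(4) cc_dist_le_cc_length[OF _ \<gamma>(1-3)] by linarith
    qed
    then show "cc_dist k p q \<le> C * (\<Sum>s\<le>k. \<bar>snd q s - snd p s\<bar>) powr (1 / (real k + 1))"
      by (simp add: h_def \<rho>_def)
  qed
qed

section \<open>The distance dominates coordinate differences\<close>

lemma coordinate_le_euclidean_jet_dist:
  "\<bar>fst p - fst q\<bar> \<le> euclidean_jet_dist k p q"
  "s \<le> k \<Longrightarrow> \<bar>snd p s - snd q s\<bar> \<le> euclidean_jet_dist k p q"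
proof -
  have nn: "0 \<le> (\<Sum>s\<le>k. (snd p s - snd q s)\<^sup>2)" by (simp add: sum_nonneg)
  then show "\<bar>fst p - fst q\<bar> \<le> euclidean_jet_dist k p q"
    unfolding euclidean_jet_dist_def by (intro real_le_rsqrt) simp
  assume "s \<le> k"
  then have "(snd p s - snd q s)\<^sup>2 \<le> (\<Sum>s\<le>k. (snd p s - snd q s)\<^sup>2)"
    by (intro member_le_sum[of s "{..k}" "\<lambda>s. (snd p s - snd q s)\<^sup>2"]) auto
  then show "\<bar>snd p s - snd q s\<bar> \<le> euclidean_jet_dist k p q"
    unfolding euclidean_jet_dist_def by (intro real_le_rsqrt) (simp add: add_increasing)
qed

lemma absolutely_continuous_curve_coordinate:
  assumes ac: "absolutely_continuous_curve k \<gamma> a b"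
    and \<phi>: "\<And>\<sigma> \<tau>. \<bar>\<phi> \<sigma> - \<phi> \<tau>\<bar> \<le> euclidean_jet_dist k (\<gamma> \<tau>) (\<gamma> \<sigma>)"
  shows "absolutely_continuous_fun \<phi> a b"
  unfolding absolutely_continuous_fun_def
proof (intro allI impI)
  fix \<epsilon> :: real assume "\<epsilon> > 0"
  then obtain \<delta> where "\<delta> > 0" and \<delta>: "\<And>(n::nat) l r.
        (\<forall>i<n. a \<le> l i \<and> l i \<le> r i \<and> r i \<le> b) \<and>
        disjoint_family_on (\<lambda>i. {l i<..<r i}) {..<n} \<and> (\<Sum>i<n. r i - l i) < \<delta>
        \<Longrightarrow> (\<Sum>i<n. euclidean_jet_dist k (\<gamma> (l i)) (\<gamma> (r i))) < \<epsilon>"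
    using ac[unfolded absolutely_continuous_curve_def, rule_format, OF \<open>\<epsilon> > 0\<close>] by auto
  show "\<exists>\<delta>>0. \<forall>(n::nat) l r.
        (\<forall>i<n. a \<le> l i \<and> l i \<le> r i \<and> r i \<le> b) \<and>
        disjoint_family_on (\<lambda>i. {l i<..<r i}) {..<n} \<and> (\<Sum>i<n. r i - l i) < \<delta>
        \<longrightarrow> (\<Sum>i<n. \<bar>\<phi> (r i) - \<phi> (l i)\<bar>) < \<epsilon>"
  proof (intro exI[of _ \<delta>] conjI allI impI \<open>\<delta> > 0\<close>)
    fix n :: nat and l r
    assume *: "(\<forall>i<n. a \<le> l i \<and> l i \<le> r i \<and> r i \<le> b) \<and>
        disjoint_family_on (\<lambda>i. {l i<..<r i}) {..<n} \<and> (\<Sum>i<n. r i - l i) < \<delta>"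
    have "(\<Sum>i<n. \<bar>\<phi> (r i) - \<phi> (l i)\<bar>) \<le> (\<Sum>i<n. euclidean_jet_dist k (\<gamma> (l i)) (\<gamma> (r i)))"
      by (intro sum_mono \<phi>)
    also have "\<dots> < \<epsilon>" by (rule \<delta>[OF *])
    finally show "(\<Sum>i<n. \<bar>\<phi> (r i) - \<phi> (l i)\<bar>) < \<epsilon>" .
  qed
qed

lemma horizontal_curve_absolutely_continuous_coordinates:
  assumes "horizontal_curve k \<gamma> a b"
  shows "absolutely_continuous_fun (\<lambda>\<sigma>. fst (\<gamma> \<sigma>)) a b"
    and "s \<le> k \<Longrightarrow> absolutely_continuous_fun (\<lambda>\<sigma>. snd (\<gamma> \<sigma>) s) a b"
proof -
  have ac: "absolutely_continuous_curve k \<gamma> a b" using assms by (simp add: horizontal_curve_def)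
  show "absolutely_continuous_fun (\<lambda>\<sigma>. fst (\<gamma> \<sigma>)) a b"
    by (rule absolutely_continuous_curve_coordinate[OF ac], subst abs_minus_commute)
      (rule coordinate_le_euclidean_jet_dist)
  show "s \<le> k \<Longrightarrow> absolutely_continuous_fun (\<lambda>\<sigma>. snd (\<gamma> \<sigma>) s) a b"
    by (rule absolutely_continuous_curve_coordinate[OF ac], subst abs_minus_commute)
      (rule coordinate_le_euclidean_jet_dist)
qed

text \<open>
  Here \<open>\<alpha>\<close> and \<open>\<beta>\<close> are almost everywhere the derivatives of the absolutely continuous functions \<open>x\<close>
  and \<open>u\<^sub>k\<close>, hence integrable; the speed lies below \<open>|\<alpha>| + |\<beta>|\<close>. Without integrability the length
  of a horizontal curve could be a spurious 0, so this is what makes lower bounds on lengths possible.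
\<close>

lemma horizontal_curve_speed:
  assumes "a < b" and hor: "horizontal_curve k \<gamma> a b"
  obtains N \<alpha> \<beta> where "negligible N"
    "\<And>\<tau>. \<tau> \<in> {a..b} - N \<Longrightarrow> has_velocity \<gamma> (frame_comb k (\<gamma> \<tau>) (\<alpha> \<tau>) (\<beta> \<tau>)) \<tau>"
    "(\<lambda>\<tau>. sqrt ((\<alpha> \<tau>)\<^sup>2 + (\<beta> \<tau>)\<^sup>2)) integrable_on {a..b}"
    "cc_length k \<gamma> a b = integral {a..b} (\<lambda>\<tau>. sqrt ((\<alpha> \<tau>)\<^sup>2 + (\<beta> \<tau>)\<^sup>2))"
proof -
  define N where "N = insert a (insert b
    {\<tau>. \<not> (\<tau> \<in> {a<..<b} \<longrightarrow> (\<exists>v \<in> horizontal_space k (\<gamma> \<tau>). has_velocity \<gamma> v \<tau>))})"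
  have "AE \<tau> in lebesgue. \<tau> \<in> {a<..<b} \<longrightarrow> (\<exists>v \<in> horizontal_space k (\<gamma> \<tau>). has_velocity \<gamma> v \<tau>)"
    using hor by (simp add: horizontal_curve_def)
  then have N: "negligible N"
    by (simp add: N_def negligible_iff_null_sets completion.AE_iff_null_sets)
  have "\<exists>\<alpha> \<beta>. has_velocity \<gamma> (frame_comb k (\<gamma> \<tau>) \<alpha> \<beta>) \<tau>" if "\<tau> \<in> {a..b} - N" for \<tau>
  proof -
    have "\<exists>v \<in> horizontal_space k (\<gamma> \<tau>). has_velocity \<gamma> v \<tau>"
      using that by (auto simp: N_def)
    then show ?thesis unfolding horizontal_space_def by blast
  qed
  then obtain \<alpha> \<beta> where vel: "\<And>\<tau>. \<tau> \<in> {a..b} - N \<Longrightarrow> has_velocity \<gamma> (frame_comb k (\<gamma> \<tau>) (\<alpha> \<tau>) (\<beta> \<tau>)) \<tau>"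
    by metis
  let ?n = "\<lambda>\<tau>. sqrt ((\<alpha> \<tau>)\<^sup>2 + (\<beta> \<tau>)\<^sup>2)"
  have \<alpha>: "\<alpha> absolutely_integrable_on {a..b}"
  proof (rule absolutely_continuous_fun_absolutely_integrable
      [OF _ horizontal_curve_absolutely_continuous_coordinates(1)[OF hor] N])
    show "((\<lambda>\<sigma>. fst (\<gamma> \<sigma>)) has_real_derivative \<alpha> x) (at x)" if "x \<in> {a..b} - N" for x
      using vel[OF that] by (simp add: has_velocity_def frame_comb_def field_X_def field_U_def)
  qed (use assms in simp)
  have \<beta>: "\<beta> absolutely_integrable_on {a..b}"
  proof (rule absolutely_continuous_fun_absolutely_integrable
      [OF _ horizontal_curve_absolutely_continuous_coordinates(2)[OF hor order_refl] N])
    show "((\<lambda>\<sigma>. snd (\<gamma> \<sigma>) k) has_real_derivative \<beta> x) (at x)" if "x \<in> {a..b} - N" for x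
      using vel[OF that] unfolding has_velocity_def
      by (simp add: frame_comb_def field_X_def field_U_def) (drule conjunct2, drule spec[of _ k], simp)
  qed (use assms in simp)
  have n: "?n absolutely_integrable_on {a..b}"
  proof (rule measurable_bounded_by_integrable_imp_absolutely_integrable)
    have [measurable]: "\<alpha> \<in> borel_measurable (lebesgue_on {a..b})" "\<beta> \<in> borel_measurable (lebesgue_on {a..b})"
      using \<alpha> \<beta> by (simp_all add: absolutely_integrable_measurable_real)
    show "?n \<in> borel_measurable (lebesgue_on {a..b})" by measurable
    show "(\<lambda>\<tau>. \<bar>\<alpha> \<tau>\<bar> + \<bar>\<beta> \<tau>\<bar>) integrable_on {a..b}"
      using \<alpha> \<beta> by (intro integrable_add) (auto simp: absolutely_integrable_on_def)
    show "norm (?n x) \<le> \<bar>\<alpha> x\<bar> + \<bar>\<beta> x\<bar>" for x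
      using sqrt_sum_squares_le_sum_abs by simp
  qed auto
  have norm_eq: "horizontal_norm k (\<gamma> \<tau>) (velocity \<gamma> \<tau>) = ?n \<tau>" if "\<tau> \<in> {a..b} - N" for \<tau>
    using has_velocity_imp_velocity[OF vel[OF that]] by (simp add: horizontal_norm_frame_comb)
  have "(\<lambda>\<tau>. horizontal_norm k (\<gamma> \<tau>) (velocity \<gamma> \<tau>)) absolutely_integrable_on {a..b}"
    by (rule absolutely_integrable_spike[OF n N norm_eq])
  then have "cc_length k \<gamma> a b = integral {a..b} (\<lambda>\<tau>. horizontal_norm k (\<gamma> \<tau>) (velocity \<gamma> \<tau>))"
    unfolding cc_length_def by (rule set_lebesgue_integral_eq_integral(2))
  also have "\<dots> = integral {a..b} ?n"
    by (rule integral_spike[OF N]) (simp add: norm_eq)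
  finally have len: "cc_length k \<gamma> a b = integral {a..b} ?n" .
  show ?thesis
    by (rule that[OF N vel _ len]) (use n set_lebesgue_integral_eq_integral(1) in blast)+
qed

lemma horizontal_curve_fst_increment:
  assumes "a < b" and hor: "horizontal_curve k \<gamma> a b"
  shows "\<bar>fst (\<gamma> b) - fst (\<gamma> a)\<bar> \<le> cc_length k \<gamma> a b"
proof -
  obtain N \<alpha> \<beta> where N: "negligible N"
    and vel: "\<And>\<tau>. \<tau> \<in> {a..b} - N \<Longrightarrow> has_velocity \<gamma> (frame_comb k (\<gamma> \<tau>) (\<alpha> \<tau>) (\<beta> \<tau>)) \<tau>"
    and n: "(\<lambda>\<tau>. sqrt ((\<alpha> \<tau>)\<^sup>2 + (\<beta> \<tau>)\<^sup>2)) integrable_on {a..b}"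
    and len: "cc_length k \<gamma> a b = integral {a..b} (\<lambda>\<tau>. sqrt ((\<alpha> \<tau>)\<^sup>2 + (\<beta> \<tau>)\<^sup>2))"
    using horizontal_curve_speed[OF assms] by blast
  have "\<bar>fst (\<gamma> b) - fst (\<gamma> a)\<bar> \<le> 1 * integral {a..b} (\<lambda>\<tau>. sqrt ((\<alpha> \<tau>)\<^sup>2 + (\<beta> \<tau>)\<^sup>2))"
  proof (rule absolutely_continuous_fun_increment_le
      [OF _ horizontal_curve_absolutely_continuous_coordinates(1)[OF hor] N _ _ n])
    show "((\<lambda>\<sigma>. fst (\<gamma> \<sigma>)) has_real_derivative \<alpha> x) (at x)" if "x \<in> {a..b} - N" for x
      using vel[OF that] by (simp add: has_velocity_def frame_comb_def field_X_def field_U_def)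
    show "\<bar>\<alpha> x\<bar> \<le> 1 * sqrt ((\<alpha> x)\<^sup>2 + (\<beta> x)\<^sup>2)" for x by simp
  qed (use assms in simp)
  then show ?thesis by (simp add: len)
qed

text \<open>
  Induction on \<open>j\<close>, downwards from \<open>u\<^sub>k\<close>: since \<open>u\<^sub>s' = \<alpha> u\<^sub>s\<^sub>+\<^sub>1\<close>, a bound for \<open>u\<^sub>s\<^sub>+\<^sub>1\<close> along
  the whole curve turns into one for the increments of \<open>u\<^sub>s\<close>. That the length is at most 1 keeps
  the bound affine in \<open>R\<close>.
\<close>

lemma horizontal_curve_snd_increment:
  assumes "a < b" and hor: "horizontal_curve k \<gamma> a b"
    and R: "\<And>s. s \<le> k \<Longrightarrow> \<bar>snd (\<gamma> a) s\<bar> \<le> R"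
    and short: "cc_length k \<gamma> a b \<le> 1"
    and "j \<le> k" "\<tau> \<in> {a..b}"
  shows "\<bar>snd (\<gamma> \<tau>) (k - j) - snd (\<gamma> a) (k - j)\<bar> \<le> (1 + real j * R) * cc_length k \<gamma> a b"
proof -
  define l where "l = cc_length k \<gamma> a b"
  have "R \<ge> 0" using R[of 0] by linarith
  obtain N \<alpha> \<beta> where N: "negligible N"
    and vel: "\<And>\<tau>. \<tau> \<in> {a..b} - N \<Longrightarrow> has_velocity \<gamma> (frame_comb k (\<gamma> \<tau>) (\<alpha> \<tau>) (\<beta> \<tau>)) \<tau>"
    and n: "(\<lambda>\<tau>. sqrt ((\<alpha> \<tau>)\<^sup>2 + (\<beta> \<tau>)\<^sup>2)) integrable_on {a..b}"
    and len: "cc_length k \<gamma> a b = integral {a..b} (\<lambda>\<tau>. sqrt ((\<alpha> \<tau>)\<^sup>2 + (\<beta> \<tau>)\<^sup>2))"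
    using horizontal_curve_speed[OF assms(1,2)] by blast
  let ?n = "\<lambda>\<tau>. sqrt ((\<alpha> \<tau>)\<^sup>2 + (\<beta> \<tau>)\<^sup>2)"
  have vel_s: "((\<lambda>\<sigma>. snd (\<gamma> \<sigma>) s) has_real_derivative
      (if s < k then \<alpha> \<tau> * snd (\<gamma> \<tau>) (Suc s) else if s = k then \<beta> \<tau> else 0)) (at \<tau>)"
    if "\<tau> \<in> {a..b} - N" for s \<tau>
  proof -
    have "((\<lambda>\<sigma>. snd (\<gamma> \<sigma>) s) has_real_derivative snd (frame_comb k (\<gamma> \<tau>) (\<alpha> \<tau>) (\<beta> \<tau>)) s) (at \<tau>)"
      using vel[OF that] by (simp add: has_velocity_def)
    then show ?thesis by (auto simp: frame_comb_def field_X_def field_U_def split: if_splits)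
  qed
  have increment: "\<bar>snd (\<gamma> \<tau>) s - snd (\<gamma> a) s\<bar> \<le> M * l"
    if "s \<le> k" "M \<ge> 0" "\<tau> \<in> {a..b}"
      and bound: "\<And>x. x \<in> {a..b} - N \<Longrightarrow>
        \<bar>if s < k then \<alpha> x * snd (\<gamma> x) (Suc s) else if s = k then \<beta> x else 0\<bar> \<le> M * ?n x" for s M \<tau>
  proof -
    have sub: "{a..\<tau>} \<subseteq> {a..b}" using that(3) by auto
    have n': "?n integrable_on {a..\<tau>}"
      using n sub by (rule integrable_on_subinterval)
    have "\<bar>snd (\<gamma> \<tau>) s - snd (\<gamma> a) s\<bar> \<le> M * integral {a..\<tau>} ?n"
    proof (rule absolutely_continuous_fun_increment_le[OF _ _ N _ _ n'])
      show "absolutely_continuous_fun (\<lambda>\<sigma>. snd (\<gamma> \<sigma>) s) a \<tau>"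
        by (rule absolutely_continuous_fun_subinterval
            [OF horizontal_curve_absolutely_continuous_coordinates(2)[OF hor \<open>s \<le> k\<close>]])
          (use that(3) in auto)
      show "((\<lambda>\<sigma>. snd (\<gamma> \<sigma>) s) has_real_derivative
          (if s < k then \<alpha> x * snd (\<gamma> x) (Suc s) else if s = k then \<beta> x else 0)) (at x)"
        if "x \<in> {a..\<tau>} - N" for x
        using vel_s that sub by blast
      show "\<bar>if s < k then \<alpha> x * snd (\<gamma> x) (Suc s) else if s = k then \<beta> x else 0\<bar> \<le> M * ?n x"
        if "x \<in> {a..\<tau>} - N" for x
        using bound that sub by blast
    qed (use that(3) in simp)
    also have "\<dots> \<le> M * l"
      unfolding l_def len using n n' sub \<open>M \<ge> 0\<close>
      by (intro mult_left_mono integral_subset_le) auto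
    finally show ?thesis .
  qed
  have "l \<ge> 0" using cc_length_nonneg[OF hor] by (simp add: l_def)
  have "\<forall>\<tau>\<in>{a..b}. \<bar>snd (\<gamma> \<tau>) (k - j) - snd (\<gamma> a) (k - j)\<bar> \<le> (1 + real j * R) * l"
    using \<open>j \<le> k\<close>
  proof (induction j)
    case 0
    have "\<bar>\<beta> x\<bar> \<le> 1 * ?n x" for x by simp
    then show ?case
      using increment[of k 1] by (auto simp del: real_sqrt_abs)
  next
    case (Suc j)
    define s where "s = k - Suc j"
    have s: "s < k" "Suc s = k - j" using Suc.prems by (auto simp: s_def)
    show ?case
    proof
      fix \<tau> assume \<tau>: "\<tau> \<in> {a..b}"
      have "\<bar>snd (\<gamma> \<tau>) s - snd (\<gamma> a) s\<bar> \<le> (1 + real (Suc j) * R) * l"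
      proof (rule increment[OF _ _ \<tau>])
        fix x assume x: "x \<in> {a..b} - N"
        have "\<bar>snd (\<gamma> x) (Suc s) - snd (\<gamma> a) (Suc s)\<bar> \<le> (1 + real j * R) * l"
          using Suc x s by auto
        also have "\<dots> \<le> (1 + real j * R) * 1"
          using short \<open>R \<ge> 0\<close> by (intro mult_left_mono) (auto simp: l_def)
        finally have u: "\<bar>snd (\<gamma> x) (Suc s)\<bar> \<le> 1 + real (Suc j) * R"
          using R[of "Suc s"] s by (simp add: algebra_simps)
        have "\<bar>\<alpha> x * snd (\<gamma> x) (Suc s)\<bar> = \<bar>snd (\<gamma> x) (Suc s)\<bar> * \<bar>\<alpha> x\<bar>" by (simp add: abs_mult)
        also have "\<dots> \<le> (1 + real (Suc j) * R) * ?n x"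
          using u \<open>R \<ge> 0\<close> by (intro mult_mono) auto
        finally show "\<bar>if s < k then \<alpha> x * snd (\<gamma> x) (Suc s) else if s = k then \<beta> x else 0\<bar>
            \<le> (1 + real (Suc j) * R) * ?n x" using s by simp
      qed (use s \<open>R \<ge> 0\<close> in auto)
      then show "\<bar>snd (\<gamma> \<tau>) (k - Suc j) - snd (\<gamma> a) (k - Suc j)\<bar> \<le> (1 + real (Suc j) * R) * l"
        by (simp add: s_def)
    qed
  qed
  then show ?thesis using \<open>\<tau> \<in> {a..b}\<close> by (simp add: l_def)
qed

text \<open>
  Curves of length at most 1 are covered by the increment estimates; for longer ones the trivial bound
  \<open>2 R\<close> on the difference of coordinates is already at most \<open>2 R\<close> times the length.
\<close>

lemma coordinate_le_cc_dist:
  assumes p: "p \<in> jet_space k" "\<bar>fst p\<bar> \<le> R" "\<And>s. s \<le> k \<Longrightarrow> \<bar>snd p s\<bar> \<le> R"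
    and q: "q \<in> jet_space k" "\<bar>fst q\<bar> \<le> R" "\<And>s. s \<le> k \<Longrightarrow> \<bar>snd q s\<bar> \<le> R"
  shows "\<bar>fst p - fst q\<bar> \<le> (1 + (real k + 2) * R) * cc_dist k p q"
    and "s \<le> k \<Longrightarrow> \<bar>snd p s - snd q s\<bar> \<le> (1 + (real k + 2) * R) * cc_dist k p q"
proof -
  let ?C = "1 + (real k + 2) * R"
  have "R \<ge> 0" using p(2) by linarith
  have "(real k + 2) * R \<ge> 0" "real k * R \<ge> 0" using \<open>R \<ge> 0\<close> by simp_all
  then have C: "?C > 0" "?C \<ge> 1" "?C \<ge> 2 * R" by (simp_all add: distrib_right)
  have C': "?C \<ge> 1 + real j * R" if "j \<le> k" for j
    using \<open>R \<ge> 0\<close> that by (intro add_left_mono mult_right_mono) auto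
  have step: "c \<le> ?C * cc_dist k p q"
    if "c \<le> 2 * R" and short: "\<And>\<gamma> a b. a < b \<Longrightarrow> horizontal_curve k \<gamma> a b \<Longrightarrow> \<gamma> a = p \<Longrightarrow> \<gamma> b = q \<Longrightarrow>
       cc_length k \<gamma> a b \<le> 1 \<Longrightarrow> c \<le> ?C * cc_length k \<gamma> a b" for c
  proof -
    have "c / ?C \<le> cc_dist k p q"
    proof (rule cc_dist_greatest[OF p(1) q(1)])
      fix \<gamma> a b assume *: "a < b" "horizontal_curve k \<gamma> a b" "\<gamma> a = p" "\<gamma> b = q"
      have "c \<le> ?C * cc_length k \<gamma> a b"
      proof (cases "cc_length k \<gamma> a b \<le> 1")
        case False
        have "c \<le> ?C * 1" unfolding mult_1_right using that(1) C(3) by (rule order_trans)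
        also have "\<dots> \<le> ?C * cc_length k \<gamma> a b"
          using C(1) False by (intro mult_left_mono) auto
        finally show ?thesis .
      qed (use short * in blast)
      then show "c / ?C \<le> cc_length k \<gamma> a b"
        using C(1) by (simp add: pos_divide_le_eq mult.commute)
    qed
    then show ?thesis using C(1) by (simp add: pos_divide_le_eq mult.commute)
  qed
  show "\<bar>fst p - fst q\<bar> \<le> ?C * cc_dist k p q"
  proof (rule step)
    show "\<bar>fst p - fst q\<bar> \<le> 2 * R" using p(2) q(2) by linarith
    fix \<gamma> a b assume *: "a < b" "horizontal_curve k \<gamma> a b" "\<gamma> a = p" "\<gamma> b = q"
    have "\<bar>fst p - fst q\<bar> \<le> 1 * cc_length k \<gamma> a b"
      using horizontal_curve_fst_increment[OF *(1,2)] *(3,4) by (simp add: abs_minus_commute)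
    also have "\<dots> \<le> ?C * cc_length k \<gamma> a b"
      using C(2) cc_length_nonneg[OF *(2)] by (rule mult_right_mono)
    finally show "\<bar>fst p - fst q\<bar> \<le> ?C * cc_length k \<gamma> a b" .
  qed
  show "\<bar>snd p s - snd q s\<bar> \<le> ?C * cc_dist k p q" if s: "s \<le> k"
  proof (rule step)
    show "\<bar>snd p s - snd q s\<bar> \<le> 2 * R" using p(3)[OF s] q(3)[OF s] by linarith
    fix \<gamma> a b assume *: "a < b" "horizontal_curve k \<gamma> a b" "\<gamma> a = p" "\<gamma> b = q" "cc_length k \<gamma> a b \<le> 1"
    have "\<bar>snd p s - snd q s\<bar> \<le> (1 + real (k - s) * R) * cc_length k \<gamma> a b"
      using horizontal_curve_snd_increment[OF *(1,2) _ *(5), of R "k - s" b] p(3) *(1,3,4) s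
      by (simp add: abs_minus_commute)
    also have "\<dots> \<le> ?C * cc_length k \<gamma> a b"
      using C'[of "k - s"] cc_length_nonneg[OF *(2)] by (intro mult_right_mono) auto
    finally show "\<bar>snd p s - snd q s\<bar> \<le> ?C * cc_length k \<gamma> a b" .
  qed
qed

section \<open>The jet group and vertical maps in coordinates\<close>

text \<open>
  The Taylor shift \<open>exp (y N)\<close>, where \<open>N\<close> is the nilpotent operator \<open>(N u)\<^sub>s = u\<^sub>s\<^sub>+\<^sub>1\<close>: it turns the
  jet at a point of a polynomial of degree at most \<open>k\<close> into its jet at distance \<open>y\<close>.
\<close>

definition jet_shift :: "nat \<Rightarrow> real \<Rightarrow> (nat \<Rightarrow> real) \<Rightarrow> nat \<Rightarrow> real" where
  "jet_shift k y u s = (if s \<le> k then \<Sum>j=s..k. u j * (y ^ (j - s) / fact (j - s)) else 0)"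

lemma jet_shift_add: "jet_shift k y (\<lambda>s. u s + v s) s = jet_shift k y u s + jet_shift k y v s"
  by (simp add: jet_shift_def algebra_simps sum.distrib add_divide_distrib)

lemma jet_shift_diff: "jet_shift k y (\<lambda>s. u s - v s) s = jet_shift k y u s - jet_shift k y v s"
  by (simp add: jet_shift_def algebra_simps sum_subtractf diff_divide_distrib)

lemma jet_shift_minus: "jet_shift k y (\<lambda>s. - v s) s = - jet_shift k y v s"
  by (simp add: jet_shift_def sum_negf)

lemma jet_shift_zero:
  assumes "\<And>s. s > k \<Longrightarrow> u s = 0"
  shows "jet_shift k 0 u = u"
proof
  fix s
  have "(\<Sum>j=s..k. u j * (0 ^ (j - s) / fact (j - s))) = (\<Sum>j=s..k. if j = s then u j else 0)"
    by (intro sum.cong) auto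
  then show "jet_shift k 0 u s = u s"
    using assms by (simp add: jet_shift_def)
qed

text \<open>
  This is \<open>exp (y N) exp (z N) = exp ((y + z) N)\<close>; after exchanging the two sums it reduces to the
  binomial theorem for divided powers.
\<close>

lemma jet_shift_shift: "jet_shift k y (jet_shift k z u) = jet_shift k (y + z) u"
proof
  fix s
  show "jet_shift k y (jet_shift k z u) s = jet_shift k (y + z) u s"
  proof (cases "s \<le> k")
    case True
    let ?e = "\<lambda>y n. y ^ n / fact n :: real"
    have exp_add: "?e (y + z) n = (\<Sum>m\<le>n. ?e y m * ?e z (n - m))" for n
      using exp_series_add_commuting[of y z n] by (simp add: divide_inverse mult.commute)
    have "jet_shift k y (jet_shift k z u) s
        = (\<Sum>j=s..k. \<Sum>i\<in>{i\<in>{s..k}. j \<le> i}. u i * ?e z (i - j) * ?e y (j - s))"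
      using True unfolding jet_shift_def sum_distrib_right
      by (auto intro!: sum.cong simp: sum_distrib_right simp del: times_divide_eq_right times_divide_eq_left)
    also have "\<dots> = (\<Sum>i=s..k. \<Sum>j\<in>{j\<in>{s..k}. j \<le> i}. u i * ?e z (i - j) * ?e y (j - s))"
      by (rule sum.swap_restrict) auto
    also have "\<dots> = (\<Sum>i=s..k. u i * ?e (y + z) (i - s))"
    proof (rule sum.cong)
      fix i assume i: "i \<in> {s..k}"
      have "(\<Sum>j\<in>{j\<in>{s..k}. j \<le> i}. u i * ?e z (i - j) * ?e y (j - s))
          = (\<Sum>m\<le>i - s. u i * ?e z (i - (s + m)) * ?e y m)"
        using i by (intro sum.reindex_bij_witness[of _ "\<lambda>m. s + m" "\<lambda>j. j - s"]) auto
      also have "\<dots> = u i * ?e (y + z) (i - s)"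
        unfolding exp_add sum_distrib_left by (intro sum.cong) (simp_all add: mult_ac)
      finally show "(\<Sum>j\<in>{j\<in>{s..k}. j \<le> i}. u i * ?e z (i - j) * ?e y (j - s)) = u i * ?e (y + z) (i - s)" .
    qed simp
    finally show ?thesis using True by (simp add: jet_shift_def)
  qed (simp add: jet_shift_def)
qed

lemma jet_mult_eq:
  assumes "q \<in> jet_space k"
  shows "jet_mult k p q = (fst p + fst q, \<lambda>s. jet_shift k (fst q) (snd p) s + snd q s)"
  using assms by (auto simp: jet_mult_def jet_shift_def jet_space_def sum.atLeast_Suc_atMost not_le)

lemma jet_shift_above: "s > k \<Longrightarrow> jet_shift k y u s = 0"
  by (simp add: jet_shift_def)

lemma group_jet_group: "group (jet_group k)"
proof (rule groupI)
  show "\<one>\<^bsub>jet_group k\<^esub> \<in> carrier (jet_group k)"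
    by (simp add: jet_group_def jet_space_def)
  show closed: "x \<otimes>\<^bsub>jet_group k\<^esub> y \<in> carrier (jet_group k)" for x y
    by (simp add: jet_group_def jet_space_def jet_mult_def)
  show "x \<otimes>\<^bsub>jet_group k\<^esub> y \<otimes>\<^bsub>jet_group k\<^esub> z = x \<otimes>\<^bsub>jet_group k\<^esub> (y \<otimes>\<^bsub>jet_group k\<^esub> z)"
    if "x \<in> carrier (jet_group k)" "y \<in> carrier (jet_group k)" "z \<in> carrier (jet_group k)" for x y z
    using that closed[of y z]
    by (simp add: jet_group_def jet_mult_eq jet_shift_add jet_shift_shift add.commute add.left_commute)
  show "\<one>\<^bsub>jet_group k\<^esub> \<otimes>\<^bsub>jet_group k\<^esub> x = x" if "x \<in> carrier (jet_group k)" for x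
    using that jet_shift_diff[of k "fst x" "\<lambda>_. 0" "\<lambda>_. 0"] by (simp add: jet_group_def jet_mult_eq)
  show "\<exists>y\<in>carrier (jet_group k). y \<otimes>\<^bsub>jet_group k\<^esub> x = \<one>\<^bsub>jet_group k\<^esub>"
    if x: "x \<in> carrier (jet_group k)" for x
  proof
    let ?y = "(- fst x, \<lambda>s. - jet_shift k (- fst x) (snd x) s)"
    show "?y \<in> carrier (jet_group k)"
      by (simp add: jet_group_def jet_space_def jet_shift_above)
    show "?y \<otimes>\<^bsub>jet_group k\<^esub> x = \<one>\<^bsub>jet_group k\<^esub>"
      using x by (simp add: jet_group_def jet_mult_eq jet_shift_minus jet_shift_shift jet_shift_zero jet_space_def)
  qed
qed

lemma inv_jet_group:
  assumes "x \<in> jet_space k"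
  shows "inv\<^bsub>jet_group k\<^esub> x = (- fst x, \<lambda>s. - jet_shift k (- fst x) (snd x) s)"
proof (rule group.inv_equality[OF group_jet_group])
  let ?y = "(- fst x, \<lambda>s. - jet_shift k (- fst x) (snd x) s)"
  show "?y \<otimes>\<^bsub>jet_group k\<^esub> x = \<one>\<^bsub>jet_group k\<^esub>"
    using assms by (simp add: jet_group_def jet_mult_eq jet_shift_minus jet_shift_shift jet_shift_zero jet_space_def)
qed (use assms in \<open>simp_all add: jet_group_def jet_space_def jet_shift_above\<close>)

lemma vertical_map_eq:
  assumes "p \<in> jet_space k"
  shows "vertical_map k f t p =
    (t, jet_shift k (t - fst p) (\<lambda>s. snd p s - (deriv ^^ s) f (fst p - t)))"
proof -
  let ?J = "jet_of k f (fst p - t)"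
  have J: "?J \<in> jet_space k" by (simp add: jet_space_def jet_of_def)
  \<comment> \<open>The inverse is a jet over \<open>t - fst p\<close>, whence the first coordinate \<open>t\<close> of the product.\<close>
  have inv_J: "inv\<^bsub>jet_group k\<^esub> ?J = (t - fst p, \<lambda>s. - jet_shift k (t - fst p) (snd ?J) s)"
    using inv_jet_group[OF J] by (simp add: jet_of_def)
  have "(t - fst p, \<lambda>s. - jet_shift k (t - fst p) (snd ?J) s) \<in> jet_space k"
    by (simp add: jet_space_def jet_shift_above)
  then have "vertical_map k f t p =
      (t, \<lambda>s. jet_shift k (t - fst p) (snd p) s - jet_shift k (t - fst p) (snd ?J) s)"
    unfolding vertical_map_def inv_J by (simp add: jet_group_def jet_mult_eq)
  moreover have "jet_shift k (t - fst p) (snd ?J) s = jet_shift k (t - fst p) (\<lambda>s. (deriv ^^ s) f (fst p - t)) s" for s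
    by (auto simp: jet_shift_def jet_of_def intro!: sum.cong)
  ultimately show ?thesis by (auto simp: jet_shift_diff)
qed

section \<open>Bounded Lipschitz functions for a given distance\<close>

text \<open>
  The distance is a parameter because the Carnot--Caratheodory distance does not come from a metric
  space instance. Boundedness is included to make the class closed under products.
\<close>

definition bounded_lipschitz_wrt :: "('a \<Rightarrow> 'a \<Rightarrow> real) \<Rightarrow> 'a set \<Rightarrow> ('a \<Rightarrow> real) \<Rightarrow> bool" where
  "bounded_lipschitz_wrt d K F \<longleftrightarrow>
     (\<exists>B. \<forall>p\<in>K. \<bar>F p\<bar> \<le> B) \<and> (\<exists>C. \<forall>p\<in>K. \<forall>q\<in>K. \<bar>F p - F q\<bar> \<le> C * d p q)"

lemma bounded_lipschitz_wrtE:
  assumes "bounded_lipschitz_wrt d K F" "\<And>p q. p \<in> K \<Longrightarrow> q \<in> K \<Longrightarrow> 0 \<le> d p q"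
  obtains B C where "B \<ge> 0" "C \<ge> 0" "\<And>p. p \<in> K \<Longrightarrow> \<bar>F p\<bar> \<le> B"
    "\<And>p q. p \<in> K \<Longrightarrow> q \<in> K \<Longrightarrow> \<bar>F p - F q\<bar> \<le> C * d p q"
proof -
  obtain B C where BC: "\<And>p. p \<in> K \<Longrightarrow> \<bar>F p\<bar> \<le> B" "\<And>p q. p \<in> K \<Longrightarrow> q \<in> K \<Longrightarrow> \<bar>F p - F q\<bar> \<le> C * d p q"
    using assms(1) unfolding bounded_lipschitz_wrt_def by blast
  show ?thesis
  proof (rule that[of "\<bar>B\<bar>" "\<bar>C\<bar>"])
    show "\<bar>F p\<bar> \<le> \<bar>B\<bar>" if "p \<in> K" for p using BC(1)[OF that] by linarith
    show "\<bar>F p - F q\<bar> \<le> \<bar>C\<bar> * d p q" if "p \<in> K" "q \<in> K" for p q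
      using BC(2)[OF that] mult_right_mono[OF abs_ge_self[of C] assms(2)[OF that]] by linarith
  qed auto
qed

context
  fixes d :: "'a \<Rightarrow> 'a \<Rightarrow> real" and K :: "'a set"
  assumes nonneg: "\<forall>p\<in>K. \<forall>q\<in>K. 0 \<le> d p q"
begin

private lemma d_nonneg: "p \<in> K \<Longrightarrow> q \<in> K \<Longrightarrow> 0 \<le> d p q"
  using nonneg by blast

lemma bounded_lipschitz_wrt_const: "bounded_lipschitz_wrt d K (\<lambda>_. c)"
  unfolding bounded_lipschitz_wrt_def by (intro conjI exI[of _ "\<bar>c\<bar>"] exI[of _ 0]) auto

lemma bounded_lipschitz_wrt_add:
  assumes "bounded_lipschitz_wrt d K F" "bounded_lipschitz_wrt d K G"
  shows "bounded_lipschitz_wrt d K (\<lambda>p. F p + G p)"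
proof -
  obtain B C where F: "\<And>p. p \<in> K \<Longrightarrow> \<bar>F p\<bar> \<le> B" "\<And>p q. p \<in> K \<Longrightarrow> q \<in> K \<Longrightarrow> \<bar>F p - F q\<bar> \<le> C * d p q"
    using assms(1) unfolding bounded_lipschitz_wrt_def by blast
  obtain B' C' where G: "\<And>p. p \<in> K \<Longrightarrow> \<bar>G p\<bar> \<le> B'" "\<And>p q. p \<in> K \<Longrightarrow> q \<in> K \<Longrightarrow> \<bar>G p - G q\<bar> \<le> C' * d p q"
    using assms(2) unfolding bounded_lipschitz_wrt_def by blast
  show ?thesis unfolding bounded_lipschitz_wrt_def
  proof (intro conjI exI ballI)
    show "\<bar>F p + G p\<bar> \<le> B + B'" if "p \<in> K" for p using F(1)[OF that] G(1)[OF that] by linarith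
    show "\<bar>F p + G p - (F q + G q)\<bar> \<le> (C + C') * d p q" if "p \<in> K" "q \<in> K" for p q
      using F(2)[OF that] G(2)[OF that] unfolding distrib_right by linarith
  qed
qed

lemma bounded_lipschitz_wrt_mult:
  assumes "bounded_lipschitz_wrt d K F" "bounded_lipschitz_wrt d K G"
  shows "bounded_lipschitz_wrt d K (\<lambda>p. F p * G p)"
proof -
  obtain B C where F: "B \<ge> 0" "C \<ge> 0" "\<And>p. p \<in> K \<Longrightarrow> \<bar>F p\<bar> \<le> B"
      "\<And>p q. p \<in> K \<Longrightarrow> q \<in> K \<Longrightarrow> \<bar>F p - F q\<bar> \<le> C * d p q"
    using bounded_lipschitz_wrtE[OF assms(1) d_nonneg] by blast
  obtain B' C' where G: "B' \<ge> 0" "C' \<ge> 0" "\<And>p. p \<in> K \<Longrightarrow> \<bar>G p\<bar> \<le> B'"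
      "\<And>p q. p \<in> K \<Longrightarrow> q \<in> K \<Longrightarrow> \<bar>G p - G q\<bar> \<le> C' * d p q"
    using bounded_lipschitz_wrtE[OF assms(2) d_nonneg] by blast
  show ?thesis unfolding bounded_lipschitz_wrt_def
  proof (intro conjI exI ballI)
    show "\<bar>F p * G p\<bar> \<le> B * B'" if "p \<in> K" for p
      unfolding abs_mult using F(3)[OF that] G(3)[OF that] F(1) by (intro mult_mono) auto
    fix p q assume pq: "p \<in> K" "q \<in> K"
    have "F p * G p - F q * G q = F p * (G p - G q) + (F p - F q) * G q"
      by (simp add: algebra_simps)
    then have "\<bar>F p * G p - F q * G q\<bar> \<le> \<bar>F p\<bar> * \<bar>G p - G q\<bar> + \<bar>F p - F q\<bar> * \<bar>G q\<bar>"
      by (metis abs_mult abs_triangle_ineq)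
    also have "\<dots> \<le> B * (C' * d p q) + (C * d p q) * B'"
      using F G pq d_nonneg[OF pq] by (intro add_mono mult_mono) auto
    also have "\<dots> = (B * C' + C * B') * d p q" by (simp add: algebra_simps)
    finally show "\<bar>F p * G p - F q * G q\<bar> \<le> (B * C' + C * B') * d p q" .
  qed
qed

lemma bounded_lipschitz_wrt_diff:
  assumes "bounded_lipschitz_wrt d K F" "bounded_lipschitz_wrt d K G"
  shows "bounded_lipschitz_wrt d K (\<lambda>p. F p - G p)"
  using bounded_lipschitz_wrt_add[OF assms(1)
      bounded_lipschitz_wrt_mult[OF bounded_lipschitz_wrt_const[of "- 1"] assms(2)]] by simp

lemma bounded_lipschitz_wrt_power:
  assumes "bounded_lipschitz_wrt d K F"
  shows "bounded_lipschitz_wrt d K (\<lambda>p. F p ^ n)"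
  by (induction n) (auto intro: bounded_lipschitz_wrt_const bounded_lipschitz_wrt_mult assms)

lemma bounded_lipschitz_wrt_sum:
  assumes "\<And>i. i \<in> I \<Longrightarrow> bounded_lipschitz_wrt d K (F i)"
  shows "bounded_lipschitz_wrt d K (\<lambda>p. \<Sum>i\<in>I. F i p)"
  using assms
  by (induction I rule: infinite_finite_induct)
    (auto intro: bounded_lipschitz_wrt_const bounded_lipschitz_wrt_add)

lemma bounded_lipschitz_wrt_compose_C1:
  fixes \<phi> :: "real \<Rightarrow> real"
  assumes F: "bounded_lipschitz_wrt d K F"
    and der: "\<And>x. (\<phi> has_real_derivative \<phi>' x) (at x)" and cont: "continuous_on UNIV \<phi>'"
  shows "bounded_lipschitz_wrt d K (\<lambda>p. \<phi> (F p))"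
proof -
  obtain B C where F: "B \<ge> 0" "C \<ge> 0" "\<And>p. p \<in> K \<Longrightarrow> \<bar>F p\<bar> \<le> B"
      "\<And>p q. p \<in> K \<Longrightarrow> q \<in> K \<Longrightarrow> \<bar>F p - F q\<bar> \<le> C * d p q"
    using bounded_lipschitz_wrtE[OF assms(1) d_nonneg] by blast
  have Fin: "F p \<in> {- B..B}" if "p \<in> K" for p using F(3)[OF that] by (auto simp: abs_le_iff)
  have "continuous_on {- B..B} \<phi>"
    using der by (intro continuous_at_imp_continuous_on) (auto intro: DERIV_isCont)
  then have "bounded (\<phi> ` {- B..B})"
    by (intro compact_imp_bounded compact_continuous_image compact_Icc)
  then obtain M0 where M0: "\<And>x. x \<in> {- B..B} \<Longrightarrow> \<bar>\<phi> x\<bar> \<le> M0"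
    unfolding bounded_iff by (metis imageI real_norm_def)
  have "bounded (\<phi>' ` {- B..B})"
    by (intro compact_imp_bounded compact_continuous_image compact_Icc continuous_on_subset[OF cont]) simp
  then obtain M where M: "\<And>x. x \<in> {- B..B} \<Longrightarrow> \<bar>\<phi>' x\<bar> \<le> M"
    unfolding bounded_iff by (metis imageI real_norm_def)
  have "M \<ge> 0" using M[of 0] F(1) by (auto intro: order_trans[OF abs_ge_zero])
  show ?thesis unfolding bounded_lipschitz_wrt_def
  proof (intro conjI exI ballI)
    show "\<bar>\<phi> (F p)\<bar> \<le> M0" if "p \<in> K" for p using M0[OF Fin[OF that]] .
    fix p q assume pq: "p \<in> K" "q \<in> K"
    have "norm (\<phi> (F p) - \<phi> (F q)) \<le> M * norm (F p - F q)"
      by (rule field_differentiable_bound[of "{- B..B}" \<phi> \<phi>'])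
        (use der M Fin pq in \<open>auto intro: has_field_derivative_at_within\<close>)
    also have "\<dots> \<le> M * (C * d p q)"
      using F(4)[OF pq] \<open>M \<ge> 0\<close> by (intro mult_left_mono) auto
    finally show "\<bar>\<phi> (F p) - \<phi> (F q)\<bar> \<le> (M * C) * d p q" by (simp add: mult.assoc)
  qed
qed

end

section \<open>Hoelder continuity of vertical maps\<close>

lemma smooth_imp_has_real_derivative:
  assumes "smooth f"
  shows "((deriv ^^ n) f has_real_derivative (deriv ^^ Suc n) f x) (at x)"
  using assms by (simp add: smooth_def field_differentiable_derivI)

lemma compact_jets_bounded:
  assumes "compact K"
  obtains R where "\<And>p. p \<in> K \<Longrightarrow> \<bar>fst p\<bar> \<le> R" "\<And>p s. p \<in> K \<Longrightarrow> s \<le> k \<Longrightarrow> \<bar>snd (p :: jet) s\<bar> \<le> R"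
proof -
  have bdd: "\<exists>B. \<forall>p\<in>K. \<bar>F p\<bar> \<le> B" if "continuous_on K F" for F :: "jet \<Rightarrow> real"
    using compact_imp_bounded[OF compact_continuous_image[OF that assms]] by (auto simp: bounded_iff)
  obtain B where B: "\<And>p. p \<in> K \<Longrightarrow> \<bar>fst p\<bar> \<le> B"
    using bdd[OF continuous_on_fst[OF continuous_on_id]] by blast
  have "\<exists>B. \<forall>p\<in>K. \<bar>snd p s\<bar> \<le> B" for s
    by (rule bdd, rule continuous_on_product_then_coordinatewise) (intro continuous_intros)
  then obtain b where b: "\<And>s p. p \<in> K \<Longrightarrow> \<bar>snd p s\<bar> \<le> b s" by metis
  define R where "R = max B (Max (b ` {..k}))"
  show ?thesis
  proof (rule that[of R])
    show "\<bar>fst p\<bar> \<le> R" if "p \<in> K" for p using B[OF that] by (simp add: R_def)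
    fix p s assume "p \<in> K" "s \<le> k"
    then have "b s \<le> Max (b ` {..k})" by (intro Max_ge) auto
    then show "\<bar>snd p s\<bar> \<le> R" using b[OF \<open>p \<in> K\<close>, of s] by (simp add: R_def)
  qed
qed

text \<open>
  By \<open>vertical_map_eq\<close> the coordinate is a sum of products of the coordinates of \<open>p\<close>, powers of
  \<open>t - x\<close> and derivatives of \<open>f\<close> at \<open>x - t\<close>; the coordinates themselves are Lipschitz on
  the bounded set \<open>K\<close>.
\<close>

lemma vertical_map_bounded_lipschitz:
  assumes f: "smooth f" and K: "compact K" "K \<subseteq> jet_space k"
  shows "bounded_lipschitz_wrt (cc_dist k) K (\<lambda>p. snd (vertical_map k f t p) s)"
proof -
  have nonneg: "\<forall>p\<in>K. \<forall>q\<in>K. 0 \<le> cc_dist k p q"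
    using K(2) by (intro ballI cc_dist_nonneg) auto
  note const = bounded_lipschitz_wrt_const[where d = "cc_dist k" and K = K, OF nonneg]
    and mult = bounded_lipschitz_wrt_mult[where d = "cc_dist k" and K = K, OF nonneg]
    and diff = bounded_lipschitz_wrt_diff[where d = "cc_dist k" and K = K, OF nonneg]
    and power = bounded_lipschitz_wrt_power[where d = "cc_dist k" and K = K, OF nonneg]
    and sum = bounded_lipschitz_wrt_sum[where d = "cc_dist k" and K = K, OF nonneg]
    and compose = bounded_lipschitz_wrt_compose_C1[where d = "cc_dist k" and K = K, OF nonneg]
  obtain R where R: "\<And>p. p \<in> K \<Longrightarrow> \<bar>fst p\<bar> \<le> R" "\<And>p s. p \<in> K \<Longrightarrow> s \<le> k \<Longrightarrow> \<bar>snd p s\<bar> \<le> R"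
    using compact_jets_bounded[OF K(1), of k] by blast
  have fst: "bounded_lipschitz_wrt (cc_dist k) K fst"
    unfolding bounded_lipschitz_wrt_def
    using R coordinate_le_cc_dist(1)[of _ k R] K(2)
    by (intro conjI exI[of _ R] exI[of _ "1 + (real k + 2) * R"]) (auto simp: subset_iff)
  have snd: "bounded_lipschitz_wrt (cc_dist k) K (\<lambda>p. snd p j)" if "j \<le> k" for j
    unfolding bounded_lipschitz_wrt_def
    using R coordinate_le_cc_dist(2)[of _ k R _ j] K(2) that
    by (intro conjI exI[of _ R] exI[of _ "1 + (real k + 2) * R"]) (auto simp: subset_iff)
  have jet: "bounded_lipschitz_wrt (cc_dist k) K (\<lambda>p. (deriv ^^ j) f (fst p - t))" for j
  proof (rule compose[OF _ smooth_imp_has_real_derivative[OF f]])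
    show "bounded_lipschitz_wrt (cc_dist k) K (\<lambda>p. fst p - t)"
      by (intro diff const fst)
    show "continuous_on UNIV ((deriv ^^ Suc j) f)"
      by (intro continuous_at_imp_continuous_on ballI
          DERIV_isCont[OF smooth_imp_has_real_derivative[OF f]])
  qed
  have shift: "bounded_lipschitz_wrt (cc_dist k) K
      (\<lambda>p. jet_shift k (t - fst p) (\<lambda>s. snd p s - (deriv ^^ s) f (fst p - t)) s)"
  proof (cases "s \<le> k")
    case True
    have "bounded_lipschitz_wrt (cc_dist k) K (\<lambda>p. \<Sum>j=s..k.
        (snd p j - (deriv ^^ j) f (fst p - t)) * ((t - fst p) ^ (j - s) * (1 / fact (j - s))))"
      by (intro sum mult diff power const fst jet snd) auto
    then show ?thesis using True by (simp add: jet_shift_def)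
  next
    case False
    then show ?thesis using const[of 0] by (simp add: jet_shift_def)
  qed
  have eq: "snd (vertical_map k f t p) s
      = jet_shift k (t - fst p) (\<lambda>s. snd p s - (deriv ^^ s) f (fst p - t)) s" if "p \<in> K" for p
    using vertical_map_eq[of p k f t] that K(2) by auto
  show ?thesis
    using shift unfolding bounded_lipschitz_wrt_def by (simp add: eq cong: ball_cong)
qed

lemma vertical_map_in_jet_hyperplane:
  "p \<in> jet_space k \<Longrightarrow> vertical_map k f t p \<in> jet_hyperplane k t"
  by (simp add: vertical_map_eq jet_hyperplane_def jet_space_def jet_shift_above)

theorem proposition3p9:
  fixes k :: nat and t :: real and f :: "real \<Rightarrow> real"
  assumes "k \<ge> 1" and "smooth f"
  shows "vertical_map k f t ` jet_space k \<subseteq> jet_hyperplane k t \<and>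
         locally_hoelder_on (1 / (real k + 1)) (jet_space k) (cc_dist k) (cc_dist k)
           (vertical_map k f t)"
proof
  show "vertical_map k f t ` jet_space k \<subseteq> jet_hyperplane k t"
    by (rule image_subsetI) (rule vertical_map_in_jet_hyperplane)
  let ?V = "vertical_map k f t" and ?\<alpha> = "1 / (real k + 1)"
  show "locally_hoelder_on ?\<alpha> (jet_space k) (cc_dist k) (cc_dist k) ?V"
    unfolding locally_hoelder_on_def
  proof (intro allI impI)
    fix K :: "jet set" assume K: "compact K \<and> K \<subseteq> jet_space k"
    have "\<exists>B C. B \<ge> 0 \<and> C \<ge> 0 \<and> (\<forall>p\<in>K. \<bar>snd (?V p) s\<bar> \<le> B) \<and>
        (\<forall>p\<in>K. \<forall>q\<in>K. \<bar>snd (?V p) s - snd (?V q) s\<bar> \<le> C * cc_dist k p q)" for s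
    proof -
      have "bounded_lipschitz_wrt (cc_dist k) K (\<lambda>p. snd (?V p) s)"
        using vertical_map_bounded_lipschitz[OF assms(2)] K by blast
      moreover have "0 \<le> cc_dist k p q" if "p \<in> K" "q \<in> K" for p q
        using that K by (intro cc_dist_nonneg) auto
      ultimately obtain B C where "B \<ge> 0" "C \<ge> 0" "\<And>p. p \<in> K \<Longrightarrow> \<bar>snd (?V p) s\<bar> \<le> B"
        "\<And>p q. p \<in> K \<Longrightarrow> q \<in> K \<Longrightarrow> \<bar>snd (?V p) s - snd (?V q) s\<bar> \<le> C * cc_dist k p q"
        by (rule bounded_lipschitz_wrtE) blast+
      then show ?thesis by (intro exI[of _ B] exI[of _ C]) simp
    qed
    then obtain B C where B: "\<And>s p. p \<in> K \<Longrightarrow> \<bar>snd (?V p) s\<bar> \<le> B s"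
      and C: "\<And>s. C s \<ge> 0"
        "\<And>s p q. p \<in> K \<Longrightarrow> q \<in> K \<Longrightarrow> \<bar>snd (?V p) s - snd (?V q) s\<bar> \<le> C s * cc_dist k p q"
      by metis
    define L where "L = (\<Sum>s\<le>k. C s)"
    \<comment> \<open>The image of \<open>K\<close> is bounded, which allows one constant \<open>A\<close> for all its pairs of points.\<close>
    define R where "R = (\<Sum>s\<le>k. 2 * \<bar>B s\<bar>)"
    have "L \<ge> 0" by (simp add: L_def C(1) sum_nonneg)
    have "R \<ge> 0" by (simp add: R_def sum_nonneg)
    obtain A where "A \<ge> 0" and A: "\<And>p q. p \<in> jet_space k \<Longrightarrow> q \<in> jet_space k \<Longrightarrow> fst p = fst q \<Longrightarrow>
        (\<Sum>s\<le>k. \<bar>snd q s - snd p s\<bar>) \<le> R \<Longrightarrow>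
        cc_dist k p q \<le> A * (\<Sum>s\<le>k. \<bar>snd q s - snd p s\<bar>) powr ?\<alpha>"
      using cc_dist_vertical_le[OF \<open>R \<ge> 0\<close>, of k] by blast
    show "\<exists>C. \<forall>p\<in>K. \<forall>q\<in>K. cc_dist k (?V p) (?V q) \<le> C * cc_dist k p q powr ?\<alpha>"
    proof (intro exI[of _ "A * L powr ?\<alpha>"] ballI)
      fix p q assume pq: "p \<in> K" "q \<in> K"
      let ?\<rho> = "\<Sum>s\<le>k. \<bar>snd (?V q) s - snd (?V p) s\<bar>"
      have "p \<in> jet_space k" "q \<in> jet_space k" using pq K by auto
      then have V: "?V p \<in> jet_space k" "?V q \<in> jet_space k" "fst (?V p) = fst (?V q)"
        by (auto simp: vertical_map_eq jet_space_def jet_shift_above)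
      have d: "cc_dist k p q \<ge> 0" using pq K by (intro cc_dist_nonneg) auto
      have "?\<rho> \<le> R"
        unfolding R_def
      proof (rule sum_mono)
        show "\<bar>snd (?V q) s - snd (?V p) s\<bar> \<le> 2 * \<bar>B s\<bar>" for s
          using B[OF pq(1), of s] B[OF pq(2), of s] by linarith
      qed
      have "?\<rho> \<le> (\<Sum>s\<le>k. C s * cc_dist k p q)"
        using C(2)[OF pq] by (intro sum_mono) (simp add: abs_minus_commute)
      also have "\<dots> = L * cc_dist k p q" by (simp add: L_def sum_distrib_right)
      finally have \<rho>: "?\<rho> \<le> L * cc_dist k p q" .
      have "cc_dist k (?V p) (?V q) \<le> A * ?\<rho> powr ?\<alpha>"
        by (rule A[OF V \<open>?\<rho> \<le> R\<close>])
      also have "\<dots> \<le> A * (L * cc_dist k p q) powr ?\<alpha>"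
        using \<rho> \<open>A \<ge> 0\<close> by (intro mult_left_mono powr_mono2) (auto simp: sum_nonneg)
      also have "\<dots> = A * L powr ?\<alpha> * cc_dist k p q powr ?\<alpha>"
        using \<open>L \<ge> 0\<close> d by (simp add: powr_mult)
      finally show "cc_dist k (?V p) (?V q) \<le> A * L powr ?\<alpha> * cc_dist k p q powr ?\<alpha>" .
    qed
  qed
qed

end
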